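(* Assume the weighted digraph $V$ on vertex set $\mathcal N$ ($|\mathcal N|=N$) has at least one spanning tree, and let $2\le k\le N$. Then for every minimal forest $F\in\tilde{\mathcal F}^{k-1}$ and every atom $\mathcal E$ of the algebra $\mathfrak A_k$, the induced subgraph $F|_{\mathcal E}$ is a tree.
   Context: $V$ is a digraph with vertex set $\mathcal N$ and real weights $v_{ij}$ on its arcs $(i,j)$. An (entering) forest is a digraph in which every vertex has at most one outgoing arc and which contains no directed cycle; its weakly connected components are called trees; the unique vertex of a tree with no outgoing arc is its root. A spanning forest is a forest which is a subgraph of $V$ with vertex set $\mathcal N$; $\mathcal F^k$ denotes the set of spanning forests consisting of exactly $k$ trees. For a subgraph $G$ of $V$, $\Upsilon^G=\sum_{(i,j)\in\mathcal AG}v_{ij}$. Put $\phi^k=\min_{F\in\mathcal F^k}\Upsilon^F$ and $\tilde{\mathcal F}^k=\{F\in\mathcal F^k:\Upsilon^F=\phi^k\}$. $\mathfrak A_k$ is the algebra of subsets of $\mathcal N$ generated (by complements and intersections) by the vertex sets of all trees of all forests in $\tilde{\mathcal F}^k$; an atom is a nonempty $\mathcal A\in\mathfrak A_k$ with $\mathcal A\cap\mathcal B\in\{\emptyset,\mathcal A\}$ for all $\mathcal B\in\mathfrak A_k$. $G|_{\mathcal S}$ denotes the subgraph of $G$ induced by $\mathcal S$. A single vertex with no arcs counts as a tree. *)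

theory Defs
  imports Complex_Main
begin

text \<open>A (directed) graph is given by a vertex set S and an arc set G (pairs (i,j) meaning arc i \<rightarrow> j).\<close>

definition is_forest :: "'a set \<Rightarrow> ('a \<times> 'a) set \<Rightarrow> bool" where
  "is_forest S G \<longleftrightarrow> G \<subseteq> S \<times> S
     \<and> (\<forall>i j l. (i, j) \<in> G \<and> (i, l) \<in> G \<longrightarrow> j = l)
     \<and> (\<forall>i. (i, i) \<notin> G\<^sup>+)"

definition weak_rel :: "'a set \<Rightarrow> ('a \<times> 'a) set \<Rightarrow> ('a \<times> 'a) set" where
  "weak_rel S G = (Id_on S \<union> G \<union> G\<inverse>)\<^sup>* \<inter> (S \<times> S)"

definition trees_of :: "'a set \<Rightarrow> ('a \<times> 'a) set \<Rightarrow> 'a set set" where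
  "trees_of S G = S // weak_rel S G"

definition is_tree :: "'a set \<Rightarrow> ('a \<times> 'a) set \<Rightarrow> bool" where
  "is_tree S G \<longleftrightarrow> is_forest S G \<and> card (trees_of S G) = 1"

definition induced :: "('a \<times> 'a) set \<Rightarrow> 'a set \<Rightarrow> ('a \<times> 'a) set" where
  "induced G E = G \<inter> (E \<times> E)"

definition spanning_forests :: "'a set \<Rightarrow> ('a \<times> 'a) set \<Rightarrow> nat \<Rightarrow> ('a \<times> 'a) set set" where
  "spanning_forests N A k = {F. F \<subseteq> A \<and> is_forest N F \<and> card (trees_of N F) = k}"

definition Upsilon :: "('a \<Rightarrow> 'a \<Rightarrow> real) \<Rightarrow> ('a \<times> 'a) set \<Rightarrow> real" where
  "Upsilon v G = (\<Sum>(i, j)\<in>G. v i j)"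

definition phi :: "'a set \<Rightarrow> ('a \<times> 'a) set \<Rightarrow> ('a \<Rightarrow> 'a \<Rightarrow> real) \<Rightarrow> nat \<Rightarrow> real" where
  "phi N A v k = Min (Upsilon v ` spanning_forests N A k)"

definition min_forests :: "'a set \<Rightarrow> ('a \<times> 'a) set \<Rightarrow> ('a \<Rightarrow> 'a \<Rightarrow> real) \<Rightarrow> nat \<Rightarrow> ('a \<times> 'a) set set" where
  "min_forests N A v k = {F \<in> spanning_forests N A k. Upsilon v F = phi N A v k}"

inductive_set forest_algebra :: "'a set \<Rightarrow> ('a \<times> 'a) set \<Rightarrow> ('a \<Rightarrow> 'a \<Rightarrow> real) \<Rightarrow> nat \<Rightarrow> 'a set set"
  for N A v k where
  gen: "F \<in> min_forests N A v k \<Longrightarrow> T \<in> trees_of N F \<Longrightarrow> T \<in> forest_algebra N A v k"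
| compl: "X \<in> forest_algebra N A v k \<Longrightarrow> N - X \<in> forest_algebra N A v k"
| inter: "X \<in> forest_algebra N A v k \<Longrightarrow> Y \<in> forest_algebra N A v k \<Longrightarrow> X \<inter> Y \<in> forest_algebra N A v k"

definition is_atom :: "'a set set \<Rightarrow> 'a set \<Rightarrow> bool" where
  "is_atom \<AA> E \<longleftrightarrow> E \<noteq> {} \<and> E \<in> \<AA> \<and> (\<forall>B\<in>\<AA>. E \<inter> B = {} \<or> E \<inter> B = E)"

end

theory Submission
  imports Defs
begin

text \<open>
  Add a vertex \<open>None\<close> and give every root of a forest an arc to it; spanning forests become
  arborescences. For a suitable price \<open>l\<close> per root, the minimal forests with \<open>k - 1\<close> and with \<open>k\<close>
  trees are exactly the arborescences of minimal total cost with that many roots. By the dual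
  (Chu--Liu--Edmonds--Fulkerson) algorithm there is a partition of the vertices into blocks and a
  digraph on the blocks such that every optimal arborescence leaves each block exactly once and
  induces an arborescence of the block digraph, and every arborescence of the block digraph arises
  in this way. Hence an atom is a union of blocks, and the question becomes unweighted.

  There, making more vertices roots only refines the partition into trees. Two distinct blocks
  neither of which has a proper dominator can be separated at the expense of at most one new root,
  by an augmenting path argument as in Menger's theorem. So the blocks of an atom have a common
  dominator \<open>d\<close> inside the atom, and the arcs of a minimal forest leave the atom only from \<open>d\<close>.
\<close>

text \<open>The obstacle is that \<open>F\<close> is optimal for \<open>k - 1\<close> trees, while
  the atom is read off the optima for \<open>k\<close> trees: two minimisation problems with no
  visible common structure. The price per root places both families among the optima of one linear
  problem, and complementary slackness then describes all of these at once: an arc leaving a block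
  has reduced cost zero, and a block is left only once. The price itself comes from a max-min of
  slopes, which yields optima with at most \<open>k - 1\<close> and with at least \<open>k\<close>
  roots, but perhaps not with exactly these numbers. The gap is closed on the block digraph: all its
  arborescences lift to the same optimal cost, so there it is free to redirect further vertices to
  the root. The same freedom turns a separation with too few roots into one with exactly
  \<open>k\<close>.\<close>

section \<open>Arborescences as parent functions\<close>

text \<open>Acyclicity is expressed by the absence of a nonempty set of vertices that is closed under
  the parent function; the parent function is irrelevant outside the vertex set.\<close>

definition arborescence :: "'b set \<Rightarrow> 'b \<Rightarrow> ('b \<times> 'b) set \<Rightarrow> ('b \<Rightarrow> 'b) \<Rightarrow> bool" where
  "arborescence V r X t \<longleftrightarrow> (\<forall>v\<in>V. (v, t v) \<in> X \<and> t v \<in> insert r V)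
     \<and> (\<forall>S. S \<subseteq> V \<longrightarrow> S \<noteq> {} \<longrightarrow> \<not> t ` S \<subseteq> S)"

inductive_set orbit :: "'b set \<Rightarrow> ('b \<Rightarrow> 'b) \<Rightarrow> 'b \<Rightarrow> 'b set" for V t x where
  start: "x \<in> orbit V t x"
| step: "y \<in> orbit V t x \<Longrightarrow> y \<in> V \<Longrightarrow> t y \<in> orbit V t x"

text \<open>In an arborescence all orbits meet in the root \<open>r\<close> outside
  \<open>V\<close>. Requiring a common point inside \<open>V\<close> expresses membership in the
  same tree once \<open>r\<close> is removed.\<close>

definition joined :: "'b set \<Rightarrow> ('b \<Rightarrow> 'b) \<Rightarrow> 'b \<Rightarrow> 'b \<Rightarrow> bool" where
  "joined V t x y \<longleftrightarrow> orbit V t x \<inter> orbit V t y \<inter> V \<noteq> {}"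

lemma orbit_trans:
  assumes "y \<in> orbit V t x" "z \<in> orbit V t y"
  shows "z \<in> orbit V t x"
  using assms(2,1) by induction (auto intro: orbit.step)

lemma orbit_subset_closed:
  assumes "x \<in> S" "\<And>y. y \<in> S \<Longrightarrow> y \<in> V \<Longrightarrow> t y \<in> S"
  shows "orbit V t x \<subseteq> S"
proof
  fix y assume "y \<in> orbit V t x"
  then show "y \<in> S" by induction (auto intro: assms)
qed

lemma orbit_outside: "x \<notin> V \<Longrightarrow> orbit V t x = {x}"
  using orbit_subset_closed[of x "{x}" V t] orbit.start[of x V t] by auto

lemma orbit_unfold:
  assumes "x \<in> V"
  shows "orbit V t x = insert x (orbit V t (t x))"
proof
  show "orbit V t x \<subseteq> insert x (orbit V t (t x))"
    by (rule orbit_subset_closed) (auto intro: orbit.intros)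
  have "t x \<in> orbit V t x" using assms by (auto intro: orbit.intros)
  then show "insert x (orbit V t (t x)) \<subseteq> orbit V t x"
    by (auto intro: orbit.start orbit_trans)
qed

text \<open>An orbit is a single path, possibly closing up into a cycle, so of two of its points one
  follows the other. This is what makes \<open>joined\<close> transitive.\<close>

lemma orbit_linear:
  assumes "y \<in> orbit V t x" "z \<in> orbit V t x"
  shows "y \<in> orbit V t z \<or> z \<in> orbit V t y"
  using assms
proof induction
  case start
  then show ?case by simp
next
  case (step y)
  then consider "y \<in> orbit V t z" | "z \<in> orbit V t y" by auto
  then show ?case
  proof cases
    case 1
    then show ?thesis using step.hyps by (auto intro: orbit.step)
  next
    case 2
    then show ?thesis using orbit_unfold[OF step.hyps(2), of t]
      by (metis insertE orbit.step orbit.start step.hyps(2))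
  qed
qed

lemma joined_sym: "joined V t x y \<Longrightarrow> joined V t y x"
  unfolding joined_def by auto

lemma joined_trans:
  assumes "joined V t x y" "joined V t y z"
  shows "joined V t x z"
proof -
  obtain a b where ab: "a \<in> orbit V t x" "a \<in> orbit V t y" "a \<in> V"
    "b \<in> orbit V t y" "b \<in> orbit V t z" "b \<in> V"
    using assms unfolding joined_def by auto
  then have "a \<in> orbit V t b \<or> b \<in> orbit V t a" by (meson orbit_linear)
  then show ?thesis using ab unfolding joined_def
    by (auto dest: orbit_trans)
qed

lemma joined_orbit: "y \<in> orbit V t x \<Longrightarrow> y \<in> V \<Longrightarrow> joined V t x y"
  unfolding joined_def by (auto intro: orbit.start)

lemma arborescence_closed_empty:
  assumes "arborescence V r X t" "S \<subseteq> V" "\<And>v. v \<in> S \<Longrightarrow> t v \<in> S"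
  shows "S = {}"
  using assms unfolding arborescence_def by (metis image_subsetI)

lemma arborescenceI:
  assumes "\<And>v. v \<in> V \<Longrightarrow> (v, t v) \<in> X" "\<And>v. v \<in> V \<Longrightarrow> t v \<in> insert r V"
    "\<And>S x. S \<subseteq> V \<Longrightarrow> x \<in> S \<Longrightarrow> (\<And>v. v \<in> S \<Longrightarrow> t v \<in> S) \<Longrightarrow> False"
  shows "arborescence V r X t"
  unfolding arborescence_def using assms by (metis ex_in_conv image_subset_iff)

lemma arborescence_arc:
  assumes "arborescence V r X t" "v \<in> V"
  shows "(v, t v) \<in> X" "t v \<in> insert r V"
  using assms unfolding arborescence_def by auto

lemma orbit_subset:
  assumes "arborescence V r X t" "x \<in> V"
  shows "orbit V t x \<subseteq> insert r V"
  by (rule orbit_subset_closed) (use assms(2) arborescence_arc(2)[OF assms(1)] in auto)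

lemma root_in_orbit:
  assumes "arborescence V r X t" "x \<in> V"
  shows "r \<in> orbit V t x"
proof (rule ccontr)
  assume "r \<notin> orbit V t x"
  then have "orbit V t x \<subseteq> V" using orbit_subset[OF assms] by auto
  then have "orbit V t x = {}"
    using arborescence_closed_empty[OF assms(1)] orbit.step by (metis subsetD)
  then show False using orbit.start by fastforce
qed

lemma arborescence_acyclic:
  assumes "arborescence V r X t" "r \<notin> V" "x \<in> V"
  shows "x \<notin> orbit V t (t x)"
proof
  assume x: "x \<in> orbit V t (t x)"
  \<comment> \<open>The vertices from which \<open>x\<close> can be reached: a cycle through
    \<open>x\<close> would make this set closed under \<open>t\<close>.\<close>
  let ?S = "{y \<in> V. x \<in> orbit V t y}"
  have "t y \<in> ?S" if "y \<in> ?S" for y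
  proof -
    have *: "x \<in> orbit V t (t y)"
      using that x orbit_unfold[of y V t] by auto
    then have "t y \<noteq> r" using orbit_outside[OF assms(2), of t] assms by auto
    then show ?thesis using * that arborescence_arc[OF assms(1)] by auto
  qed
  then have "?S = {}" using arborescence_closed_empty[OF assms(1), of ?S] by auto
  then show False using assms orbit.start[of x V t] by auto
qed

lemma orbit_antisym:
  assumes "arborescence V r X t" "r \<notin> V" "y \<in> orbit V t x" "x \<in> orbit V t y"
  shows "x = y"
proof (rule ccontr)
  assume ne: "x \<noteq> y"
  have x: "x \<in> V" using ne assms(3) orbit_outside by fastforce
  then have "y \<in> orbit V t (t x)" using orbit_unfold[OF x, of t] assms(3) ne by auto
  then have "x \<in> orbit V t (t x)" using assms(4) orbit_trans by metis
  then show False using arborescence_acyclic[OF assms(1,2) x] by simp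
qed

text \<open>For an inclusion-maximal domain \<open>W\<close>, an arc from outside into
  \<open>W \<union> R\<close> could still be appended: nothing in \<open>W\<close> points to the new
  vertex, so it closes no cycle. The last conjunct makes the uncovered part usable as a cut, both
  for existence of arborescences and for domination.\<close>

lemma maximal_branching:
  assumes fin: "finite U" and R: "R \<inter> U = {}"
  shows "\<exists>W g. W \<subseteq> U \<and> (\<forall>x\<in>W. (x, g x) \<in> X \<and> g x \<in> W \<union> R)
     \<and> (\<forall>S. S \<subseteq> W \<longrightarrow> S \<noteq> {} \<longrightarrow> \<not> g ` S \<subseteq> S)
     \<and> (\<forall>x\<in>U - W. \<forall>z\<in>W \<union> R. (x, z) \<notin> X)"
proof -
  define br where "br W g \<longleftrightarrow> W \<subseteq> U \<and> (\<forall>x\<in>W. (x, g x) \<in> X \<and> g x \<in> W \<union> R)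
     \<and> (\<forall>S. S \<subseteq> W \<longrightarrow> S \<noteq> {} \<longrightarrow> \<not> g ` S \<subseteq> S)" for W g
  let ?C = "{W. \<exists>g. br W g}"
  have "?C \<subseteq> Pow U" by (auto simp: br_def)
  then have "finite ?C" using fin finite_subset by blast
  moreover have "{} \<in> ?C" by (auto simp: br_def)
  ultimately obtain W where W: "W \<in> ?C" and max: "\<And>W'. W' \<in> ?C \<Longrightarrow> W \<subseteq> W' \<Longrightarrow> W' = W"
    using finite_has_maximal[of ?C] by (metis (no_types, lifting) ex_in_conv)
  obtain g where g: "br W g" using W by auto
  have False if x: "x \<in> U - W" and z: "z \<in> W \<union> R" and xz: "(x, z) \<in> X" for x z
  proof -
    have "br (insert x W) (g(x := z))"
      unfolding br_def
    proof (intro conjI allI impI notI)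
      fix S assume S: "S \<subseteq> insert x W" "S \<noteq> {}" and cl: "g(x := z) ` S \<subseteq> S"
      have SU: "S \<subseteq> U" using S x g by (auto simp: br_def)
      have "g ` (S \<inter> W) \<subseteq> S \<inter> W"
      proof
        fix v assume "v \<in> g ` (S \<inter> W)"
        then obtain s where s: "s \<in> S \<inter> W" "v = g s" by auto
        then have "v \<in> S" using cl x by force
        then show "v \<in> S \<inter> W" using s g SU R by (auto simp: br_def)
      qed
      then have "S \<inter> W = {}" using g unfolding br_def by (metis inf_le2)
      then have "x \<in> S" using S by auto
      then have "z \<in> S" using cl by force
      then show False using z SU R \<open>S \<inter> W = {}\<close> by auto
    qed (use g x z xz in \<open>auto simp: br_def\<close>)
    then have "insert x W \<in> ?C" by auto
    then show False using max[of "insert x W"] x by auto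
  qed
  then have "\<forall>x\<in>U - W. \<forall>z\<in>W \<union> R. (x, z) \<notin> X" by blast
  then show ?thesis using g unfolding br_def by (intro exI[of _ W] exI[of _ g]) simp
qed

text \<open>By the cut condition, the part left uncovered by a maximal branching towards
  \<open>r\<close> must be empty.\<close>

lemma arborescence_exists:
  assumes fin: "finite V" and r: "r \<notin> V"
    and cut: "\<And>S. S \<subseteq> V \<Longrightarrow> S \<noteq> {} \<Longrightarrow> \<exists>v\<in>S. \<exists>z\<in>insert r V - S. (v, z) \<in> X"
  shows "\<exists>t. arborescence V r X t"
proof -
  have "{r} \<inter> V = {}" using r by auto
  from maximal_branching[OF fin this, of X]
  obtain W g where W: "W \<subseteq> V" "\<forall>x\<in>W. (x, g x) \<in> X \<and> g x \<in> W \<union> {r}"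
    "\<forall>S. S \<subseteq> W \<longrightarrow> S \<noteq> {} \<longrightarrow> \<not> g ` S \<subseteq> S" "\<forall>x\<in>V - W. \<forall>z\<in>W \<union> {r}. (x, z) \<notin> X"
    by (elim exE conjE)
  have "W = V"
  proof (rule ccontr)
    assume "W \<noteq> V"
    then obtain v z where "v \<in> V - W" "z \<in> insert r V - (V - W)" "(v, z) \<in> X"
      using cut[of "V - W"] W(1) by blast
    then show False using W(4) by auto
  qed
  then show ?thesis using W(2,3) unfolding arborescence_def by auto
qed

text \<open>Redirecting a vertex to \<open>r\<close> only cuts walks short, so it closes no cycle
  and never joins separated vertices. Hence every root number between the present one and the number
  of possible roots is attained.\<close>

lemma add_roots:
  assumes fin: "finite V" and r: "r \<notin> V" and f: "arborescence V r Z f"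
    and le: "card {v \<in> V. f v = r} \<le> k" and Q: "k \<le> card {v \<in> V. (v, r) \<in> Z}"
  shows "\<exists>g. arborescence V r Z g \<and> card {v \<in> V. g v = r} = k
     \<and> (\<forall>x y. joined V g x y \<longrightarrow> joined V f x y)"
proof -
  let ?R = "{v \<in> V. f v = r}" and ?Q = "{v \<in> V. (v, r) \<in> Z}"
  have RQ: "?R \<subseteq> ?Q" using arborescence_arc[OF f] by auto
  obtain U where U: "?R \<subseteq> U" "U \<subseteq> ?Q" "card U = k"
    using exists_subset_between[OF le Q RQ] fin by auto
  define g where "g = (\<lambda>v. if v \<in> U then r else f v)"
  have orb: "orbit V g x \<subseteq> insert r (orbit V f x)" for x
    by (rule orbit_subset_closed) (use r in \<open>auto simp: g_def intro: orbit.intros\<close>)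
  have "arborescence V r Z g"
  proof (rule arborescenceI)
    fix S x assume S: "S \<subseteq> V" "x \<in> S" "\<And>u. u \<in> S \<Longrightarrow> g u \<in> S"
    have "S = {}"
    proof (rule arborescence_closed_empty[OF f S(1)])
      fix u assume "u \<in> S"
      then show "f u \<in> S" using S(3)[of u] S(1) r by (auto simp: g_def split: if_splits)
    qed
    then show False using S by auto
  qed (use arborescence_arc[OF f] U in \<open>auto simp: g_def\<close>)
  moreover have "{v \<in> V. g v = r} = U" using U by (auto simp: g_def)
  moreover have "joined V f x y" if "joined V g x y" for x y
    using that orb[of x] orb[of y] r unfolding joined_def by blast
  ultimately show ?thesis using U by auto
qed

section \<open>Separating undominated vertices\<close>

text \<open>One augmentation step of Menger's theorem: the orbits of the two vertices first meet in
  \<open>w\<close>; sending one of them out of the subtree below \<open>w\<close> along the branch \<open>P\<close> moves the meeting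
  point strictly closer to the root.\<close>

lemma reroute:
  fixes V :: "'b set"
  defines "C \<equiv> \<lambda>f d d'. orbit V f d \<inter> orbit V f d' \<inter> V"
  assumes r: "r \<notin> V" and f: "arborescence V r Z f"
    and fin: "finite V"
    and d: "d \<in> V" "d' \<in> V"
    and w: "w \<in> C f d d'" "C f d d' \<subseteq> orbit V f w"
    and A: "A = {x \<in> V. w \<in> orbit V f x}"
    and P: "P \<subseteq> A - orbit V f d - orbit V f d'"
    and g: "\<And>x. x \<in> P \<Longrightarrow> (x, g x) \<in> Z" "\<And>x. x \<in> P \<Longrightarrow> g x \<in> P \<union> (insert r V - A)"
      "\<And>S. S \<subseteq> P \<Longrightarrow> S \<noteq> {} \<Longrightarrow> \<not> g ` S \<subseteq> S"
    and u: "u \<in> orbit V f d" "u \<notin> orbit V f d'" "u \<in> V"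
    and y: "(u, y) \<in> Z" "y \<in> P \<union> (insert r V - A)" "P \<subseteq> orbit P g y"
  shows "\<exists>h. arborescence V r Z h \<and> C h d d' \<subset> C f d d' \<and>
    ({v \<in> V. h v = r} \<subseteq> {v \<in> V. f v = r} \<or>
     \<not> joined V h d d' \<and> card {v \<in> V. h v = r} \<le> Suc (card {v \<in> V. f v = r}))"
proof -
  \<comment> \<open>The walk from \<open>d\<close> leaves its old route at \<open>u\<close>, before
    reaching \<open>w\<close>, and follows \<open>g\<close> through \<open>P\<close> until it is out
    of \<open>A\<close>.\<close>
  define h where "h = (\<lambda>x. if x \<in> P then g x else if x = u then y else f x)"
  have wV: "w \<in> V" "w \<in> orbit V f d" "w \<in> orbit V f d'" using w by (auto simp: C_def)
  have uw: "w \<in> orbit V f u"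
    using orbit_linear[OF u(1) wV(2)] u(2) wV(3) orbit_trans by metis
  have uA: "u \<in> A" using uw u A by auto
  have PV: "P \<subseteq> V" "P \<subseteq> A" using P A by auto
  have uP: "u \<notin> P" using u P by auto
  have outA: "f x \<notin> A" if "x \<in> V - A" for x
    using that A orbit_unfold[of x V f] by auto
  have arb: "arborescence V r Z h"
  proof (rule arborescenceI)
    fix S x assume S: "S \<subseteq> V" "x \<in> S" and cl: "\<And>v. v \<in> S \<Longrightarrow> h v \<in> S"
    \<comment> \<open>Outside \<open>A\<close>, the subtree hanging at \<open>w\<close>, parents are
      unchanged and never lead back into \<open>A\<close>.\<close>
    have "S - A = {}"
    proof (rule arborescence_closed_empty[OF f])
      fix v assume v: "v \<in> S - A"
      then have "h v = f v" using uA PV by (auto simp: h_def)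
      then show "f v \<in> S - A" using cl[of v] v outA[of v] S by auto
    qed (use S in auto)
    then have SA: "S \<subseteq> A" by auto
    have "g ` (S \<inter> P) \<subseteq> S \<inter> P"
    proof
      fix v assume "v \<in> g ` (S \<inter> P)"
      then obtain s where s: "s \<in> S" "s \<in> P" "v = g s" by auto
      then have "v \<in> S" using cl[of s] by (auto simp: h_def)
      then show "v \<in> S \<inter> P" using s g(2)[of s] SA by auto
    qed
    then have SP: "S \<inter> P = {}" using g(3) by (metis inf_le2)
    have uS: "u \<notin> S"
    proof
      assume "u \<in> S"
      then have "y \<in> S" using cl[of u] uP by (auto simp: h_def)
      then show False using y(2) SA SP by auto
    qed
    have "S = {}"
    proof (rule arborescence_closed_empty[OF f S(1)])
      fix v assume "v \<in> S"
      then show "f v \<in> S" using cl[of v] SP uS by (auto simp: h_def split: if_splits)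
    qed
    then show False using S by auto
  next
    fix v assume v: "v \<in> V"
    show "(v, h v) \<in> Z" using v g(1) y(1) arborescence_arc[OF f v] by (auto simp: h_def)
    show "h v \<in> insert r V" using v g(2)[of v] y(2) arborescence_arc[OF f v] PV
      by (auto simp: h_def)
  qed
  have orb': "orbit V h d' \<subseteq> orbit V f d'"
    by (rule orbit_subset_closed) (use P u in \<open>auto simp: h_def intro: orbit.intros\<close>)
  \<comment> \<open>An upper bound for the new walk from \<open>d\<close>: the old stretch up to
    \<open>u\<close>, then \<open>P\<close>, then points outside \<open>A\<close>.\<close>
  let ?Y = "{x \<in> orbit V f d. u \<in> orbit V f x} \<union> P \<union> (V - A) \<union> {r}"
  have orb: "orbit V h d \<subseteq> ?Y"
  proof (rule orbit_subset_closed)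
    show "d \<in> ?Y" using u orbit.start by fastforce
    fix x assume x: "x \<in> ?Y" "x \<in> V"
    consider "x \<in> P" | "x = u" | "x \<in> V - A" "x \<notin> P" "x \<noteq> u"
      | "x \<in> orbit V f d" "u \<in> orbit V f x" "x \<notin> P" "x \<noteq> u"
      using x r by auto
    then show "h x \<in> ?Y"
    proof cases
      case 1
      then show ?thesis using g(2)[of x] by (auto simp: h_def)
    next
      case 2
      then show ?thesis using y(2) uP by (auto simp: h_def)
    next
      case 3
      then show ?thesis using outA[of x] arborescence_arc(2)[OF f x(2)] by (auto simp: h_def)
    next
      case 4
      then have "u \<in> orbit V f (f x)" using orbit_unfold[OF x(2), of f] by auto
      moreover have "f x \<in> orbit V f d" using 4 x by (auto intro: orbit.step)
      ultimately show ?thesis using 4 by (auto simp: h_def)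
    qed
  qed
  \<comment> \<open>Neither the stretch up to \<open>u\<close> nor \<open>P\<close> touches the walk
    of \<open>d'\<close>. A remaining common vertex thus lies outside \<open>A\<close> on that walk,
    hence strictly after \<open>w\<close>, where the two old walks coincide.\<close>
  have CC: "C h d d' \<subseteq> C f d d' - {w}"
  proof
    fix c assume "c \<in> C h d d'"
    then have c: "c \<in> V" "c \<in> orbit V f d'" "c \<in> ?Y" using orb orb' by (auto simp: C_def)
    have "c \<notin> P" using c P by auto
    moreover have "\<not> (c \<in> orbit V f d \<and> u \<in> orbit V f c)"
      using c(2) u(2) orbit_trans by metis
    ultimately have cA: "c \<in> V - A" using c r by auto
    then have "c \<in> orbit V f w" using orbit_linear[OF c(2) wV(3)] A by auto
    then have "c \<in> orbit V f d" using wV orbit_trans by metis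
    moreover have "w \<in> A" using A wV orbit.start by fastforce
    ultimately show "c \<in> C f d d' - {w}" using c cA by (auto simp: C_def)
  qed
  then have C: "C h d d' \<subset> C f d d'" using w by auto
  show ?thesis
  proof (cases "\<exists>x\<in>insert u P. h x = r")
    case False
    then have "{v \<in> V. h v = r} \<subseteq> {v \<in> V. f v = r}" by (auto simp: h_def split: if_splits)
    then show ?thesis using arb C by blast
  next
    case True
    \<comment> \<open>The detour now runs straight into \<open>r\<close>, with \<open>x\<close> as
      its last vertex. As all of it lies on one walk, \<open>x\<close> is the only possible new
      root, and the walk from \<open>d\<close> ends without touching that of
      \<open>d'\<close>.\<close>
    then obtain x where x: "x \<in> insert u P" "h x = r" by auto
    have xV: "x \<in> V" using x u PV by auto
    have ud: "u \<in> orbit V h d"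
    proof -
      have "x \<in> orbit V h d" if "x \<in> orbit V f d" "u \<in> orbit V f x" for x
        using that
      proof induction
        case start
        show ?case by (rule orbit.start)
      next
        case (step z)
        have z: "u \<in> orbit V f z" using step.prems step.hyps(2) orbit_unfold[of z V f] by auto
        have zu: "z \<noteq> u" using step.prems arborescence_acyclic[OF f r step.hyps(2)] by auto
        have "z \<notin> P" using step.hyps(1) P by auto
        then have "h z = f z" using zu by (auto simp: h_def)
        then show ?case using step.IH[OF z] step.hyps(2) orbit.step[of z V h d] by auto
      qed
      then show ?thesis using u(1) orbit.start by metis
    qed
    have yd: "y \<in> orbit V h d" using orbit.step[OF ud u(3)] uP by (auto simp: h_def)
    have "orbit P g y \<subseteq> orbit V h d"
    proof (rule orbit_subset_closed[OF yd])
      fix z assume "z \<in> orbit V h d" "z \<in> P"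
      then show "g z \<in> orbit V h d" using orbit.step[of z V h d] PV by (auto simp: h_def)
    qed
    then have Pd: "insert u P \<subseteq> orbit V h d" using y(3) ud by auto
    have last: "orbit V h z = {z, r}" if "z \<in> V" "h z = r" for z
      using orbit_unfold[OF that(1), of h] orbit_outside[OF r, of h] that by auto
    have uniq: "z = x" if z: "z \<in> insert u P" "h z = r" for z
    proof -
      have zV: "z \<in> V" using z u PV by auto
      have "z \<in> orbit V h x \<or> x \<in> orbit V h z" using orbit_linear Pd x z by (metis subsetD)
      then show ?thesis using last x z xV zV r by auto
    qed
    have "{v \<in> V. h v = r} \<subseteq> insert x {v \<in> V. f v = r}"
      using uniq by (auto simp: h_def split: if_splits)
    then have "card {v \<in> V. h v = r} \<le> card (insert x {v \<in> V. f v = r})"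
      using fin by (intro card_mono) auto
    also have "\<dots> \<le> Suc (card {v \<in> V. f v = r})" by (rule card_insert_le_m1) auto
    finally have card: "card {v \<in> V. h v = r} \<le> Suc (card {v \<in> V. f v = r})" .
    have "\<not> joined V h d d'"
    proof
      assume "joined V h d d'"
      then obtain c where c: "c \<in> orbit V h d" "c \<in> orbit V h d'" "c \<in> V" by (auto simp: joined_def)
      have "c \<in> orbit V h x \<or> x \<in> orbit V h c"
        using orbit_linear[OF c(1)] Pd x by auto
      then have "x \<in> orbit V h c" using last[OF xV x(2)] c r orbit.start by auto
      then have "x \<in> orbit V f d'" using c orb' orbit_trans by (metis subsetD)
      then show False using x P u by auto
    qed
    then show ?thesis using arb C card by blast
  qed
qed

text \<open>Cut formulation of: every path from \<open>x\<close> that leaves the vertex set passes \<open>d\<close>.\<close>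

definition dominates :: "'b set \<Rightarrow> ('b \<times> 'b) set \<Rightarrow> 'b \<Rightarrow> 'b \<Rightarrow> bool" where
  "dominates V Z d x \<longleftrightarrow> (\<exists>S\<subseteq>V - {d}. x \<in> insert d S \<and> (\<forall>(v, z)\<in>Z. v \<in> S \<longrightarrow> z \<in> insert d S))"

text \<open>Each augmentation shrinks the set of common vertices; it either creates no new root or
  separates the walks at once, so the whole induction adds at most one root. An augmentation exists
  because the first common vertex differs from \<open>d\<close> or from \<open>d'\<close> and
  therefore does not dominate it.\<close>

lemma separate_undominated:
  assumes r: "r \<notin> V" and fin: "finite V" and Z: "Z \<subseteq> V \<times> insert r V"
    and d: "d \<in> V" "d' \<in> V" "d \<noteq> d'"
    and undom: "\<And>w. w \<in> V \<Longrightarrow> dominates V Z w d \<Longrightarrow> w = d"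
      "\<And>w. w \<in> V \<Longrightarrow> dominates V Z w d' \<Longrightarrow> w = d'"
    and f: "arborescence V r Z f" "card {v \<in> V. f v = r} \<le> k"
  shows "\<exists>h. arborescence V r Z h \<and> card {v \<in> V. h v = r} \<le> Suc k \<and> \<not> joined V h d d'"
  using f
proof (induction "card (orbit V f d \<inter> orbit V f d' \<inter> V)" arbitrary: f rule: less_induct)
  case (less f)
  note f = less.prems(1)
  define C where "C f = orbit V f d \<inter> orbit V f d' \<inter> V" for f
  show ?case
  proof (cases "joined V f d d'")
    case False
    then show ?thesis using less.prems by (intro exI[of _ f]) auto
  next
    case True
    then have Cne: "C f \<noteq> {}" by (auto simp: joined_def C_def)
    have finC: "finite (C f)" using fin by (auto simp: C_def)
    have fo: "finite (orbit V f c)" if "c \<in> V" for c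
      using orbit_subset[OF f that] fin finite_subset by blast
    \<comment> \<open>The first common vertex is found as the one with the longest remaining
      walk.\<close>
    have "Max ((\<lambda>c. card (orbit V f c)) ` C f) \<in> (\<lambda>c. card (orbit V f c)) ` C f"
      using finC Cne by (intro Max_in) auto
    then obtain w where "Max ((\<lambda>c. card (orbit V f c)) ` C f) = card (orbit V f w)" and w: "w \<in> C f"
      by (rule imageE)
    then have wmax: "card (orbit V f c) \<le> card (orbit V f w)" if "c \<in> C f" for c
      using that finC by (metis Max_ge finite_imageI imageI)
    have wV: "w \<in> V" "w \<in> orbit V f d" "w \<in> orbit V f d'" using w by (auto simp: C_def)
    have Cw: "C f \<subseteq> orbit V f w"
    proof
      fix c assume c: "c \<in> C f"
      then have "c \<in> orbit V f w \<or> w \<in> orbit V f c"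
        using orbit_linear[OF _ wV(2), of c] by (auto simp: C_def)
      moreover have "c \<in> orbit V f w" if "w \<in> orbit V f c"
      proof -
        have "orbit V f w \<subseteq> orbit V f c" using that orbit_trans by (metis subsetI)
        then have "orbit V f w = orbit V f c"
          using wmax[OF c] fo[of c] c by (intro card_seteq) (auto simp: C_def)
        then show ?thesis using orbit.start by metis
      qed
      ultimately show "c \<in> orbit V f w" by auto
    qed
    define A where "A = {x \<in> V. w \<in> orbit V f x}"
    define U where "U = A - orbit V f d - orbit V f d'"
    define R where "R = insert r V - A"
    have "finite U" "R \<inter> U = {}" using fin by (auto simp: U_def A_def R_def)
    from maximal_branching[OF this, of Z] obtain W g where W: "W \<subseteq> U" "\<forall>x\<in>W. (x, g x) \<in> Z \<and> g x \<in> W \<union> R"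
      "\<forall>S. S \<subseteq> W \<longrightarrow> S \<noteq> {} \<longrightarrow> \<not> g ` S \<subseteq> S" "\<forall>x\<in>U - W. \<forall>z\<in>W \<union> R. (x, z) \<notin> Z"
      by (elim exE conjE)
    obtain a where a: "a \<in> {d, d'}" "a \<noteq> w" using d by auto
    then have nd: "\<not> dominates V Z w a" using undom wV by auto
    have aS: "a \<in> A - {w} - W"
      using a d W(1) wV orbit.start[of d V f] orbit.start[of d' V f] by (auto simp: A_def U_def)
    \<comment> \<open>This set contains \<open>a\<close>. If \<open>w\<close> were the only way out
      of it, it would witness that \<open>w\<close> dominates \<open>a\<close>.\<close>
    have "\<not> (\<forall>(v, z)\<in>Z. v \<in> A - {w} - W \<longrightarrow> z \<in> insert w (A - {w} - W))"
    proof
      assume *: "\<forall>(v, z)\<in>Z. v \<in> A - {w} - W \<longrightarrow> z \<in> insert w (A - {w} - W)"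
      have "A - {w} - W \<subseteq> V - {w}" by (auto simp: A_def)
      then show False using nd aS * unfolding dominates_def by blast
    qed
    then obtain u y where uy: "(u, y) \<in> Z" "u \<in> A - {w} - W" "y \<notin> insert w (A - {w} - W)"
      by auto
    have yR: "y \<in> W \<union> R" using uy Z by (auto simp: R_def)
    \<comment> \<open>Maximality of the branching leaves no such arc to an uncovered vertex off the
      two walks, so \<open>u\<close> lies on one of them.\<close>
    then have "u \<notin> U" using W(4) uy by blast
    then have uL: "u \<in> orbit V f d \<union> orbit V f d'" "u \<in> V" "w \<in> orbit V f u"
      using uy by (auto simp: U_def A_def)
    have unC: "u \<notin> C f"
    proof
      assume "u \<in> C f"
      then have "u \<in> orbit V f w" using Cw by auto
      then show False using uy orbit_antisym[OF f r] uL by auto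
    qed
    \<comment> \<open>Only the single path of the branching that starts at \<open>y\<close> is used;
      rerouting all of \<open>W\<close> could create several new roots.\<close>
    define P where "P = W \<inter> orbit W g y"
    have PW: "P \<subseteq> W" by (auto simp: P_def)
    have gP: "g x \<in> P \<union> R" if "x \<in> P" for x
      using that W(2) orbit.step[of x W g y] by (auto simp: P_def)
    have yP: "y \<in> P \<union> R" using yR orbit.start[of y W g] by (auto simp: P_def)
    have "orbit W g y \<subseteq> orbit P g y"
    proof
      fix z assume "z \<in> orbit W g y"
      then show "z \<in> orbit P g y"
        by induction (auto intro: orbit.intros simp: P_def)
    qed
    then have Po: "P \<subseteq> orbit P g y" by (auto simp: P_def)
    have PA: "P \<subseteq> A - orbit V f d - orbit V f d'" "P \<subseteq> A - orbit V f d' - orbit V f d"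
      using PW W(1) by (auto simp: U_def)
    have g: "(x, g x) \<in> Z" "g x \<in> P \<union> (insert r V - A)" if "x \<in> P" for x
      using that PW W(2) gP[OF that] by (auto simp: R_def)
    have acyc: "\<not> g ` S \<subseteq> S" if "S \<subseteq> P" "S \<noteq> {}" for S
      using that PW W(3) by (meson order_trans)
    have y: "y \<in> P \<union> (insert r V - A)" using yP by (simp add: R_def)
    have "\<exists>h. arborescence V r Z h \<and> C h \<subset> C f \<and>
      ({v \<in> V. h v = r} \<subseteq> {v \<in> V. f v = r} \<or>
       \<not> joined V h d d' \<and> card {v \<in> V. h v = r} \<le> Suc (card {v \<in> V. f v = r}))"
    proof (cases "u \<in> orbit V f d")
      case True
      then have "u \<notin> orbit V f d'" using unC uL by (auto simp: C_def)
      then show ?thesis unfolding C_def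
        by (intro reroute[where w = w and A = A and P = P and g = g and u = u and y = y])
          (use r f fin d w Cw A_def PA g acyc True uL uy y Po in \<open>simp_all add: C_def\<close>)
    next
      case False
      then have "u \<in> orbit V f d'" using uL by auto
      then have "\<exists>h. arborescence V r Z h \<and> orbit V h d' \<inter> orbit V h d \<inter> V \<subset> orbit V f d' \<inter> orbit V f d \<inter> V \<and>
      ({v \<in> V. h v = r} \<subseteq> {v \<in> V. f v = r} \<or>
       \<not> joined V h d' d \<and> card {v \<in> V. h v = r} \<le> Suc (card {v \<in> V. f v = r}))"
        by (intro reroute[where w = w and A = A and P = P and g = g and u = u and y = y])
          (use r f fin d w Cw A_def PA g acyc False uL uy y Po in \<open>simp_all add: C_def Int_commute\<close>)
      moreover have "orbit V h d' \<inter> orbit V h d = orbit V h d \<inter> orbit V h d'"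
        "joined V h d' d = joined V h d d'" for h
        by (auto simp: joined_def)
      ultimately show ?thesis unfolding C_def by simp
    qed
    then obtain h where h: "arborescence V r Z h" "C h \<subset> C f"
      "{v \<in> V. h v = r} \<subseteq> {v \<in> V. f v = r} \<or>
       \<not> joined V h d d' \<and> card {v \<in> V. h v = r} \<le> Suc (card {v \<in> V. f v = r})" by blast
    show ?thesis
    proof (cases "{v \<in> V. h v = r} \<subseteq> {v \<in> V. f v = r}")
      case True
      then have "card {v \<in> V. h v = r} \<le> k"
        using less.prems(2) fin card_mono[OF _ True] by auto
      moreover have "card (C h) < card (C f)" using h(2) finC psubset_card_mono by blast
      ultimately show ?thesis using less.hyps[of h] h(1) by (auto simp: C_def)
    next
      case False
      then show ?thesis using h less.prems(2) by (intro exI[of _ h]) auto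
    qed
  qed
qed

section \<open>Dominators and the exit of an inseparable class\<close>

lemma dominates_orbit:
  assumes f: "arborescence V r Z f" and dom: "dominates V Z d x"
  shows "d \<in> orbit V f x"
proof (rule ccontr)
  assume d: "d \<notin> orbit V f x"
  obtain S where S: "S \<subseteq> V - {d}" "x \<in> insert d S" "\<forall>(v, z)\<in>Z. v \<in> S \<longrightarrow> z \<in> insert d S"
    using dom unfolding dominates_def by auto
  have "orbit V f x \<inter> S = {}"
  proof (rule arborescence_closed_empty[OF f])
    fix v assume v: "v \<in> orbit V f x \<inter> S"
    then have "v \<in> V" using S by auto
    then show "f v \<in> orbit V f x \<inter> S"
      using v S(3) d arborescence_arc(1)[OF f] orbit.step[of v V f x] by fastforce
  qed (use S in auto)
  then show False using S(2) d orbit.start[of x V f] by auto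
qed

lemma dominates_trans:
  assumes "dominates V Z d x" "dominates V Z e d"
  shows "dominates V Z e x"
proof -
  obtain S where S: "S \<subseteq> V - {d}" "x \<in> insert d S" "\<forall>(v, z)\<in>Z. v \<in> S \<longrightarrow> z \<in> insert d S"
    using assms(1) unfolding dominates_def by auto
  obtain T where T: "T \<subseteq> V - {e}" "d \<in> insert e T" "\<forall>(v, z)\<in>Z. v \<in> T \<longrightarrow> z \<in> insert e T"
    using assms(2) unfolding dominates_def by auto
  \<comment> \<open>\<open>e\<close> may lie in \<open>S\<close>; as the exit of the combined set it
    has to be taken out.\<close>
  have "S \<union> T - {e} \<subseteq> V - {e}" "x \<in> insert e (S \<union> T - {e})" using S(1,2) T(1,2) by auto
  moreover have "\<forall>(v, z)\<in>Z. v \<in> S \<union> T - {e} \<longrightarrow> z \<in> insert e (S \<union> T - {e})"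
    using S(3) T(2,3) by fastforce
  ultimately show ?thesis unfolding dominates_def by blast
qed

lemma dominates_refl: "dominates V Z d d"
  unfolding dominates_def by (intro exI[of _ "{}"]) auto

lemma dominates_arc:
  assumes "dominates V Z d x" "x \<noteq> d" "(x, z) \<in> Z"
  shows "dominates V Z d z"
proof -
  obtain S where S: "S \<subseteq> V - {d}" "x \<in> insert d S" "\<forall>(v, z)\<in>Z. v \<in> S \<longrightarrow> z \<in> insert d S"
    using assms(1) unfolding dominates_def by auto
  then have "z \<in> insert d S" using assms(2,3) by auto
  then show ?thesis using S unfolding dominates_def by blast
qed

text \<open>All dominators of \<open>x\<close> lie on its walk in the one arborescence
  \<open>f\<close>. The one nearest the root is dominated only by itself, since a dominator of it
  again dominates \<open>x\<close> and lies at least as far along the walk.\<close>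

lemma top_dominator_exists:
  assumes r: "r \<notin> V" and fin: "finite V" and f: "arborescence V r Z f" and x: "x \<in> V"
  shows "\<exists>d\<in>V. dominates V Z d x \<and> (\<forall>w\<in>V. dominates V Z w d \<longrightarrow> w = d)"
proof -
  let ?m = "\<lambda>d. card (orbit V f d)"
  obtain d where d: "d \<in> V" "dominates V Z d x"
    and min: "\<And>w. w \<in> V \<and> dominates V Z w x \<Longrightarrow> ?m d \<le> ?m w"
    using x dominates_refl[of V Z x] ex_has_least_nat[of "\<lambda>d. d \<in> V \<and> dominates V Z d x" x ?m]
    by auto
  have "w = d" if w: "w \<in> V" "dominates V Z w d" for w
  proof -
    have "w \<in> orbit V f d" using dominates_orbit[OF f w(2)] .
    then have sub: "orbit V f w \<subseteq> orbit V f d" using orbit_trans by (metis subsetI)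
    have "finite (orbit V f d)" using orbit_subset[OF f d(1)] fin finite_subset by blast
    then have "orbit V f w = orbit V f d"
      using sub min[of w] w dominates_trans[OF d(2) w(2)] by (intro card_seteq) auto
    then show ?thesis using orbit_antisym[OF f r \<open>w \<in> orbit V f d\<close>] orbit.start by metis
  qed
  then show ?thesis using d by blast
qed

text \<open>A class of vertices that no \<open>Suc k\<close>-rooted arborescence separates has a vertex that
  every path from the class to the root must pass.\<close>

lemma class_has_exit:
  fixes V :: "'b set"
  assumes r: "r \<notin> V" and fin: "finite V" and Z: "Z \<subseteq> V \<times> insert r V"
    and f: "arborescence V r Z f" "card {v \<in> V. f v = r} = k"
    and Q: "Suc k \<le> card {v \<in> V. (v, r) \<in> Z}"
    and x: "x \<in> V"
    and E: "E = {y \<in> V. \<forall>g. arborescence V r Z g \<and> card {v \<in> V. g v = r} = Suc k \<longrightarrow> joined V g x y}"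
  shows "\<exists>d\<in>E. f d \<notin> E \<and> (\<forall>y\<in>E - {d}. f y \<in> E)"
proof -
  define top where "top d y \<longleftrightarrow> d \<in> V \<and> dominates V Z d y \<and> (\<forall>w\<in>V. dominates V Z w d \<longrightarrow> w = d)" for d y
  have ex: "\<exists>d. top d y" if "y \<in> V" for y
    using top_dominator_exists[OF r fin f(1) that] unfolding top_def by blast
  \<comment> \<open>A dominator is on the walk of \<open>y\<close> in every arborescence, so the
    class contains both or neither.\<close>
  have dE: "d \<in> E \<longleftrightarrow> y \<in> E" if "d \<in> V" "y \<in> V" "dominates V Z d y" for d y
  proof -
    have "joined V g y d" if "arborescence V r Z g" for g
      using joined_orbit[OF dominates_orbit[OF that \<open>dominates V Z d y\<close>] \<open>d \<in> V\<close>] .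
    then show ?thesis unfolding E using that by (blast intro: joined_trans joined_sym)
  qed
  \<comment> \<open>Two distinct undominated vertices can be separated with at most
    \<open>Suc k\<close> roots. Filling up to exactly \<open>Suc k\<close> roots keeps them apart,
    against the definition of \<open>E\<close>.\<close>
  have uniq: "d = d'" if d: "d \<in> E" "d' \<in> E" "top d y" "top d' y'" for d d' y y'
  proof (rule ccontr)
    assume "d \<noteq> d'"
    then obtain h where h: "arborescence V r Z h" "card {v \<in> V. h v = r} \<le> Suc k" "\<not> joined V h d d'"
      using separate_undominated[OF r fin Z, of d d' f k] f d unfolding top_def by auto
    obtain g where g: "arborescence V r Z g" "card {v \<in> V. g v = r} = Suc k"
      "joined V g d d' \<longrightarrow> joined V h d d'"
      using add_roots[OF fin r h(1,2) Q] by blast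
    have "joined V g x d" "joined V g x d'" using d(1,2) g unfolding E by auto
    then show False using g(3) h(3) joined_trans joined_sym by metis
  qed
  obtain d where d: "top d x" using ex[OF x] by auto
  have xE: "x \<in> E" unfolding E using x joined_orbit[OF orbit.start x] by auto
  then have dinE: "d \<in> E" using dE[of d x] d x unfolding top_def by auto
  have domE: "dominates V Z d y" if y: "y \<in> E" for y
  proof -
    have "y \<in> V" using y E by auto
    then obtain d' where d': "top d' y" using ex by auto
    then have "d' \<in> E" using dE[of d' y] y \<open>y \<in> V\<close> unfolding top_def by auto
    then show ?thesis using uniq[OF dinE _ d d'] d' unfolding top_def by auto
  qed
  have dV: "d \<in> V" using dinE E by auto
  \<comment> \<open>Otherwise \<open>d\<close> would dominate \<open>f d\<close>, and the walk would
    return to \<open>d\<close>.\<close>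
  have "f d \<notin> E"
    using domE[of "f d"] dominates_orbit[OF f(1)] arborescence_acyclic[OF f(1) r dV] by blast
  moreover have "f y \<in> E" if y: "y \<in> E - {d}" for y
  proof -
    have yV: "y \<in> V" using y E by auto
    have dom: "dominates V Z d (f y)"
      using dominates_arc[OF domE[of y]] y arborescence_arc(1)[OF f(1) yV] by auto
    have "f y \<noteq> r"
      using dominates_orbit[OF f(1) dom] orbit_outside[OF r, of f] dV r by auto
    then have "f y \<in> V" using arborescence_arc(2)[OF f(1) yV] by auto
    then show ?thesis using dE[OF dV _ dom] dinE by auto
  qed
  ultimately show ?thesis using dinE by blast
qed

section \<open>Reduced costs and blocks\<close>

text \<open>\<open>\<pi>\<close> labels the blocks of a partition of the vertices, \<open>c\<close> is a reduced cost on the arcs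
  and \<open>K\<close> the accumulated dual value: choosing one exit arc per block acyclically always extends
  to an arborescence whose cost is \<open>K\<close> plus the reduced cost of the exits.\<close>

definition reduction ::
    "'b set \<Rightarrow> 'b \<Rightarrow> ('b \<times> 'b) set \<Rightarrow> ('b \<Rightarrow> 'b \<Rightarrow> real) \<Rightarrow> ('b \<Rightarrow> 'b) \<Rightarrow> ('b \<Rightarrow> 'b \<Rightarrow> real) \<Rightarrow> real \<Rightarrow> bool" where
  "reduction V r X w \<pi> c K \<longleftrightarrow> \<pi> r = r \<and> \<pi> ` V \<subseteq> V \<and> (\<forall>(v, z)\<in>X. 0 \<le> c v z)
     \<and> (\<forall>p\<in>\<pi> ` V. \<exists>(v, z)\<in>X. \<pi> v = p \<and> \<pi> z \<noteq> p \<and> c v z = 0)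
     \<and> (\<forall>t. arborescence V r X t \<longrightarrow>
          K + (\<Sum>v | v \<in> V \<and> \<pi> (t v) \<noteq> \<pi> v. c v (t v)) \<le> (\<Sum>v\<in>V. w v (t v))
          \<and> (K + (\<Sum>v | v \<in> V \<and> \<pi> (t v) \<noteq> \<pi> v. c v (t v)) = (\<Sum>v\<in>V. w v (t v)) \<longrightarrow>
               inj_on \<pi> {v \<in> V. \<pi> (t v) \<noteq> \<pi> v}))
     \<and> (\<forall>e z. (\<forall>p\<in>\<pi> ` V. (e p, z p) \<in> X \<and> \<pi> (e p) = p) \<longrightarrow>
          arborescence (\<pi> ` V) r UNIV (\<lambda>p. \<pi> (z p)) \<longrightarrow>
          (\<exists>t. arborescence V r X t \<and> (\<forall>p\<in>\<pi> ` V. t (e p) = z p)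
             \<and> (\<forall>v\<in>V. v \<noteq> e (\<pi> v) \<longrightarrow> \<pi> (t v) = \<pi> v)
             \<and> (\<Sum>v\<in>V. w v (t v)) = K + (\<Sum>p\<in>\<pi> ` V. c (e p) (z p))))"

lemma reduction_extend:
  assumes "reduction V r X w \<pi> c K"
    and "\<forall>p\<in>\<pi> ` V. (e p, z p) \<in> X \<and> \<pi> (e p) = p"
    and "arborescence (\<pi> ` V) r UNIV (\<lambda>p. \<pi> (z p))"
  shows "\<exists>t. arborescence V r X t \<and> (\<forall>p\<in>\<pi> ` V. t (e p) = z p)
    \<and> (\<forall>v\<in>V. v \<noteq> e (\<pi> v) \<longrightarrow> \<pi> (t v) = \<pi> v)
    \<and> (\<Sum>v\<in>V. w v (t v)) = K + (\<Sum>p\<in>\<pi> ` V. c (e p) (z p))"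
  using assms unfolding reduction_def by blast

lemma arborescence_no_loop:
  assumes "arborescence V r X t" "v \<in> V"
  shows "t v \<noteq> v"
  using arborescence_closed_empty[OF assms(1), of "{v}"] assms(2) by auto

text \<open>The dual starts from singleton blocks, with \<open>K\<close> collecting the cost of a
  cheapest outgoing arc at each vertex. The arcs to \<open>r\<close> ensure that there is
  one.\<close>

lemma reduction_initial:
  assumes fin: "finite V" and r: "r \<notin> V" and X: "X \<subseteq> V \<times> insert r V" "\<And>v. (v, v) \<notin> X"
    and Xr: "V \<times> {r} \<subseteq> X"
  shows "\<exists>\<pi> c K. reduction V r X w \<pi> c K"
proof -
  define m where "m v = Min ((\<lambda>z. w v z) ` {z. (v, z) \<in> X})" for v
  define c where "c v z = w v z - m v" for v z
  have finX: "finite {z. (v, z) \<in> X}" for v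
    by (rule finite_subset[of _ "insert r V"]) (use X fin in auto)
  have m_le: "m v \<le> w v z" if "(v, z) \<in> X" for v z
    unfolding m_def using that finX[of v] by (intro Min_le) auto
  have m_ex: "\<exists>z. (v, z) \<in> X \<and> w v z = m v" if "v \<in> V" for v
  proof -
    have "m v \<in> (\<lambda>z. w v z) ` {z. (v, z) \<in> X}"
      unfolding m_def using finX[of v] Xr that by (intro Min_in) auto
    then show ?thesis by auto
  qed
  have cost: "(\<Sum>v\<in>V. w v (t v)) = (\<Sum>v\<in>V. m v) + (\<Sum>v\<in>V. c v (t v))" for t
    by (simp add: c_def sum_subtractf)
  have "reduction V r X w (\<lambda>v. v) c (\<Sum>v\<in>V. m v)"
    unfolding reduction_def
  proof (intro conjI allI impI)
    show "\<forall>(v, z)\<in>X. 0 \<le> c v z" using m_le by (auto simp: c_def)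
    show "\<forall>p\<in>(\<lambda>v. v) ` V. \<exists>(v, z)\<in>X. v = p \<and> z \<noteq> p \<and> c v z = 0"
    proof
      fix p assume "p \<in> (\<lambda>v. v) ` V"
      then obtain z where "(p, z) \<in> X" "w p z = m p" using m_ex by auto
      then show "\<exists>(v, z)\<in>X. v = p \<and> z \<noteq> p \<and> c v z = 0"
        using X(2)[of p] by (intro bexI[of _ "(p, z)"]) (auto simp: c_def)
    qed
  next
    fix t assume t: "arborescence V r X t"
    have "{v \<in> V. t v \<noteq> v} = V" using arborescence_no_loop[OF t] by auto
    then show "(\<Sum>v\<in>V. m v) + (\<Sum>v | v \<in> V \<and> t v \<noteq> v. c v (t v)) \<le> (\<Sum>v\<in>V. w v (t v))"
      using cost[of t] by simp
    show "inj_on (\<lambda>v. v) {v \<in> V. t v \<noteq> v}" by (simp add: inj_on_def)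
  next
    fix e z assume ez: "\<forall>p\<in>(\<lambda>v. v) ` V. (e p, z p) \<in> X \<and> e p = p"
      and arb: "arborescence ((\<lambda>v. v) ` V) r UNIV (\<lambda>p. z p)"
    show "\<exists>t. arborescence V r X t \<and> (\<forall>p\<in>(\<lambda>v. v) ` V. t (e p) = z p)
             \<and> (\<forall>v\<in>V. v \<noteq> e v \<longrightarrow> t v = v)
             \<and> (\<Sum>v\<in>V. w v (t v)) = (\<Sum>v\<in>V. m v) + (\<Sum>p\<in>(\<lambda>v. v) ` V. c (e p) (z p))"
      using ez arb cost[of z] by (intro exI[of _ z]) (auto simp: arborescence_def)
  qed auto
  then show ?thesis by blast
qed

text \<open>The dual step of the Chu--Liu--Edmonds--Fulkerson algorithm: a minimal set of blocks without
  outgoing arcs of zero reduced cost is strongly connected by such arcs, so it can be merged after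
  lowering the cost of its outgoing arcs.\<close>

lemma reduction_merge:
  assumes fin: "finite V" and r: "r \<notin> V" and X: "X \<subseteq> V \<times> insert r V"
    and Xr: "V \<times> {r} \<subseteq> X"
    and red: "reduction V r X w \<pi> c K"
    and S: "S \<subseteq> \<pi> ` V" "S \<noteq> {}"
    and closed: "\<And>v z. (v, z) \<in> X \<Longrightarrow> \<pi> v \<in> S \<Longrightarrow> c v z = 0 \<Longrightarrow> \<pi> z \<in> S"
    and minimal: "\<And>S'. S' \<subset> S \<Longrightarrow> S' \<noteq> {} \<Longrightarrow> \<exists>(v, z)\<in>X. \<pi> v \<in> S' \<and> c v z = 0 \<and> \<pi> z \<notin> S'"
  shows "\<exists>\<pi>' c' K'. reduction V r X w \<pi>' c' K' \<and> card (\<pi>' ` V) < card (\<pi> ` V)"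
proof -
  have pr: "\<pi> r = r" and pV: "\<pi> ` V \<subseteq> V" and c0: "\<And>v z. (v, z) \<in> X \<Longrightarrow> 0 \<le> c v z"
    using red unfolding reduction_def by auto
  have zero: "\<exists>v z. (v, z) \<in> X \<and> \<pi> v = p \<and> \<pi> z \<noteq> p \<and> c v z = 0" if "p \<in> \<pi> ` V" for p
    using red that unfolding reduction_def by blast
  have lower: "K + (\<Sum>v | v \<in> V \<and> \<pi> (t v) \<noteq> \<pi> v. c v (t v)) \<le> (\<Sum>v\<in>V. w v (t v))"
    and lower_inj: "K + (\<Sum>v | v \<in> V \<and> \<pi> (t v) \<noteq> \<pi> v. c v (t v)) = (\<Sum>v\<in>V. w v (t v)) \<Longrightarrow>
      inj_on \<pi> {v \<in> V. \<pi> (t v) \<noteq> \<pi> v}" if "arborescence V r X t" for t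
    using red that unfolding reduction_def by blast+
  have SV: "S \<subseteq> V" using S pV by auto
  have finS: "finite S" using SV fin finite_subset by auto
  have rS: "r \<notin> S" using SV r by auto
  obtain s where s: "s \<in> S" using S by auto
  define \<pi>' where "\<pi>' x = (if \<pi> x \<in> S then s else \<pi> x)" for x
  define L where "L = {(v, z). (v, z) \<in> X \<and> \<pi> v \<in> S \<and> \<pi> z \<notin> S}"
  \<comment> \<open>The largest dual increase for \<open>S\<close> that keeps reduced costs
    nonnegative. It is positive because no arc of zero reduced cost leaves \<open>S\<close>.\<close>
  define \<delta> where "\<delta> = Min ((\<lambda>(v, z). c v z) ` L)"
  define c' where "c' v z = (if (v, z) \<in> L then c v z - \<delta> else c v z)" for v z
  have finX: "finite X" using X fin finite_subset by (metis finite_SigmaI finite_insert)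
  have "L \<subseteq> X" by (auto simp: L_def)
  then have finL: "finite L" using finX finite_subset by auto
  have Lne: "L \<noteq> {}"
  proof -
    obtain v where "v \<in> V" "\<pi> v = s" using s S by auto
    then have "(v, r) \<in> L" using Xr s rS pr by (auto simp: L_def)
    then show ?thesis by auto
  qed
  have d_le: "\<delta> \<le> c v z" if "(v, z) \<in> L" for v z
    unfolding \<delta>_def using that finL by (intro Min_le) auto
  have "\<delta> \<in> (\<lambda>(v, z). c v z) ` L" unfolding \<delta>_def using finL Lne by (intro Min_in) auto
  then obtain v0 z0 where vz0: "(v0, z0) \<in> L" "c v0 z0 = \<delta>" by auto
  have d_pos: "\<delta> > 0"
  proof -
    have "c v0 z0 \<noteq> 0" using closed[of v0 z0] vz0 by (auto simp: L_def)
    moreover have "0 \<le> c v0 z0" using c0 vz0 by (auto simp: L_def)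
    ultimately show ?thesis using vz0 by auto
  qed
  have c'0: "0 \<le> c' v z" if "(v, z) \<in> X" for v z
    using that c0 d_le by (auto simp: c'_def)
  have pi'_iff: "\<pi>' x \<noteq> \<pi>' v \<longleftrightarrow> \<pi> x \<noteq> \<pi> v" if "\<pi> v \<notin> S" for x v
    using that s by (auto simp: \<pi>'_def)
  have pi'_S: "\<pi>' x \<noteq> \<pi>' v \<longleftrightarrow> \<pi> x \<notin> S" if "\<pi> v \<in> S" for x v
    using that s by (auto simp: \<pi>'_def)
  have P': "\<pi>' ` V = insert s (\<pi> ` V - S)"
    using s S by (auto simp: \<pi>'_def image_iff split: if_splits)
  have "card (\<pi>' ` V) < card (\<pi> ` V)"
  proof -
    obtain v z where "(v, z) \<in> X" "\<pi> v = s" "\<pi> z \<noteq> s" "c v z = 0" using zero[of s] s S by blast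
    then have z: "\<pi> z \<in> S" "\<pi> z \<noteq> s" using closed[of v z] s by auto
    have "\<pi>' ` V \<subseteq> \<pi> ` V" using P' s S by auto
    moreover have "\<pi> z \<notin> \<pi>' ` V" "\<pi> z \<in> \<pi> ` V" using z P' S by auto
    ultimately have "\<pi>' ` V \<subset> \<pi> ` V" by blast
    then show ?thesis using fin by (intro psubset_card_mono) auto
  qed
  moreover have "reduction V r X w \<pi>' c' (K + \<delta>)"
    unfolding reduction_def
  proof (intro conjI)
    show "\<pi>' r = r" using pr rS by (auto simp: \<pi>'_def)
    show "\<pi>' ` V \<subseteq> V" using P' s SV pV by auto
    show "\<forall>(v, z)\<in>X. 0 \<le> c' v z" using c'0 by auto
    show "\<forall>p\<in>\<pi>' ` V. \<exists>(v, z)\<in>X. \<pi>' v = p \<and> \<pi>' z \<noteq> p \<and> c' v z = 0"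
    proof
      fix p assume "p \<in> \<pi>' ` V"
      then consider "p = s" | "p \<in> \<pi> ` V" "p \<notin> S" using P' by auto
      then show "\<exists>(v, z)\<in>X. \<pi>' v = p \<and> \<pi>' z \<noteq> p \<and> c' v z = 0"
      proof cases
        case 1
        then show ?thesis using vz0 s
          by (intro bexI[of _ "(v0, z0)"]) (auto simp: L_def c'_def \<pi>'_def)
      next
        case 2
        then obtain v z where "(v, z) \<in> X" "\<pi> v = p" "\<pi> z \<noteq> p" "c v z = 0" using zero by blast
        then show ?thesis using 2 s
          by (intro bexI[of _ "(v, z)"]) (auto simp: L_def c'_def \<pi>'_def)
      qed
    qed
    show "\<forall>t. arborescence V r X t \<longrightarrow>
          K + \<delta> + (\<Sum>v | v \<in> V \<and> \<pi>' (t v) \<noteq> \<pi>' v. c' v (t v)) \<le> (\<Sum>v\<in>V. w v (t v))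
          \<and> (K + \<delta> + (\<Sum>v | v \<in> V \<and> \<pi>' (t v) \<noteq> \<pi>' v. c' v (t v)) = (\<Sum>v\<in>V. w v (t v)) \<longrightarrow>
               inj_on \<pi>' {v \<in> V. \<pi>' (t v) \<noteq> \<pi>' v})"
    proof (intro allI impI)
      fix t assume t: "arborescence V r X t"
      define M where "M = {v \<in> V. \<pi> (t v) \<noteq> \<pi> v}"
      define M' where "M' = {v \<in> V. \<pi>' (t v) \<noteq> \<pi>' v}"
      \<comment> \<open>The exits of the merged block. Acyclicity gives at least one, and each
        lowers the reduced cost by \<open>\<delta>\<close>, which pays for the increase of
        \<open>K\<close>. Equality leaves exactly one, which is the injectivity demanded for the
        merged block.\<close>
      define B where "B = {v \<in> V. \<pi> v \<in> S \<and> \<pi> (t v) \<notin> S}"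
      have finM: "finite M" "finite M'" "finite B" using fin by (auto simp: M_def M'_def B_def)
      have MM: "M' \<subseteq> M" "B \<subseteq> M'"
        unfolding M_def M'_def B_def using pi'_iff pi'_S by (auto simp: \<pi>'_def)
      have tX: "(v, t v) \<in> X" if "v \<in> V" for v using arborescence_arc(1)[OF t that] .
      have c'B: "c' v (t v) = c v (t v) - (if v \<in> B then \<delta> else 0)" if "v \<in> M'" for v
        using that tX[of v] by (auto simp: M'_def B_def c'_def L_def)
      have "(\<Sum>v\<in>M'. c' v (t v)) = (\<Sum>v\<in>M'. c v (t v)) - (\<Sum>v\<in>M'. if v \<in> B then \<delta> else 0)"
        using c'B by (simp add: sum_subtractf)
      also have "(\<Sum>v\<in>M'. if v \<in> B then \<delta> else 0) = (\<Sum>v\<in>B. \<delta>)"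
        using MM finM by (simp add: sum.If_cases inf.absorb2)
      finally have sum': "(\<Sum>v\<in>M'. c' v (t v)) = (\<Sum>v\<in>M'. c v (t v)) - card B * \<delta>" by simp
      have sumM: "(\<Sum>v\<in>M'. c v (t v)) \<le> (\<Sum>v\<in>M. c v (t v))"
        using MM finM c0 tX by (intro sum_mono2) (auto simp: M_def)
      have Bne: "B \<noteq> {}"
      proof
        assume B: "B = {}"
        have "{v \<in> V. \<pi> v \<in> S} = {}"
        proof (rule arborescence_closed_empty[OF t])
          fix v assume v: "v \<in> {v \<in> V. \<pi> v \<in> S}"
          then have "\<pi> (t v) \<in> S" using B by (auto simp: B_def)
          then show "t v \<in> {v \<in> V. \<pi> v \<in> S}"
            using v arborescence_arc(2)[OF t, of v] pr rS by auto
        qed auto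
        then show False using s S by auto
      qed
      then have cB: "card B \<ge> 1" using finM by (simp add: Suc_leI card_gt_0_iff)
      then have dB: "\<delta> \<le> card B * \<delta>" using d_pos by simp
      have low: "K + (\<Sum>v\<in>M. c v (t v)) \<le> (\<Sum>v\<in>V. w v (t v))"
        using lower[OF t] by (simp add: M_def)
      show "K + \<delta> + (\<Sum>v | v \<in> V \<and> \<pi>' (t v) \<noteq> \<pi>' v. c' v (t v)) \<le> (\<Sum>v\<in>V. w v (t v))
          \<and> (K + \<delta> + (\<Sum>v | v \<in> V \<and> \<pi>' (t v) \<noteq> \<pi>' v. c' v (t v)) = (\<Sum>v\<in>V. w v (t v)) \<longrightarrow>
               inj_on \<pi>' {v \<in> V. \<pi>' (t v) \<noteq> \<pi>' v})"
        unfolding M'_def[symmetric]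
      proof (intro conjI impI)
        show "K + \<delta> + (\<Sum>v\<in>M'. c' v (t v)) \<le> (\<Sum>v\<in>V. w v (t v))"
          using sum' sumM dB low by linarith
        assume eq: "K + \<delta> + (\<Sum>v\<in>M'. c' v (t v)) = (\<Sum>v\<in>V. w v (t v))"
        then have "K + (\<Sum>v\<in>M. c v (t v)) = (\<Sum>v\<in>V. w v (t v))" "card B * \<delta> = \<delta>"
          using sum' sumM dB low by linarith+
        then have inj: "inj_on \<pi> M" and "card B = 1"
          using lower_inj[OF t] d_pos by (auto simp: M_def)
        then obtain b where b: "B = {b}" using card_1_singletonE by blast
        show "inj_on \<pi>' M'"
        proof (rule inj_onI)
          fix x y assume xy: "x \<in> M'" "y \<in> M'" "\<pi>' x = \<pi>' y"
          show "x = y"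
          proof (cases "\<pi> x \<in> S")
            case True
            then have "\<pi> y \<in> S" using xy s by (auto simp: \<pi>'_def split: if_splits)
            then have "x \<in> B" "y \<in> B" using True xy pi'_S by (auto simp: B_def M'_def)
            then show ?thesis using b by auto
          next
            case False
            then have "\<pi> x = \<pi> y" using xy s by (auto simp: \<pi>'_def split: if_splits)
            then show ?thesis using inj xy MM by (auto dest: inj_onD)
          qed
        qed
      qed
    qed
    show "\<forall>e z. (\<forall>p\<in>\<pi>' ` V. (e p, z p) \<in> X \<and> \<pi>' (e p) = p) \<longrightarrow>
          arborescence (\<pi>' ` V) r UNIV (\<lambda>p. \<pi>' (z p)) \<longrightarrow>
          (\<exists>t. arborescence V r X t \<and> (\<forall>p\<in>\<pi>' ` V. t (e p) = z p)
             \<and> (\<forall>v\<in>V. v \<noteq> e (\<pi>' v) \<longrightarrow> \<pi>' (t v) = \<pi>' v)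
             \<and> (\<Sum>v\<in>V. w v (t v)) = K + \<delta> + (\<Sum>p\<in>\<pi>' ` V. c' (e p) (z p)))"
    proof (intro allI impI)
      fix e' z'
      assume ez: "\<forall>p\<in>\<pi>' ` V. (e' p, z' p) \<in> X \<and> \<pi>' (e' p) = p"
        and arb': "arborescence (\<pi>' ` V) r UNIV (\<lambda>p. \<pi>' (z' p))"
      have sP': "s \<in> \<pi>' ` V" using P' by auto
      \<comment> \<open>The exit prescribed for the merged block starts in the old block
        \<open>q\<close>. The other old blocks of \<open>S\<close> receive zero-cost exits leading
        towards \<open>q\<close>; these exist because no nonempty proper subset of \<open>S\<close>
        is closed.\<close>
      define q where "q = \<pi> (e' s)"
      have q: "q \<in> S" 
        using ez sP' s P' by (auto simp: q_def \<pi>'_def split: if_splits)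
      define Z where "Z = {(\<pi> v, \<pi> z) |v z. (v, z) \<in> X \<and> c v z = 0}"
      have "\<exists>g. arborescence (S - {q}) q Z g"
      proof (rule arborescence_exists)
        fix S' assume S': "S' \<subseteq> S - {q}" "S' \<noteq> {}"
        then have "S' \<subset> S" using q by auto
        then obtain v z where vz: "(v, z) \<in> X" "\<pi> v \<in> S'" "c v z = 0" "\<pi> z \<notin> S'"
          using minimal[OF _ S'(2)] by auto
        then have "\<pi> z \<in> S" using closed[of v z] S' by auto
        then show "\<exists>v\<in>S'. \<exists>z\<in>insert q (S - {q}) - S'. (v, z) \<in> Z"
          using vz by (intro bexI[of _ "\<pi> v"] bexI[of _ "\<pi> z"]) (auto simp: Z_def)
      qed (use finS in auto)
      then obtain g where g: "arborescence (S - {q}) q Z g" by auto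
      have "\<forall>p\<in>S - {q}. \<exists>vz. vz \<in> X \<and> c (fst vz) (snd vz) = 0 \<and> \<pi> (fst vz) = p \<and> \<pi> (snd vz) = g p"
      proof
        fix p assume "p \<in> S - {q}"
        then have "(p, g p) \<in> Z" using arborescence_arc(1)[OF g] by auto
        then obtain v z where "(v, z) \<in> X" "c v z = 0" "\<pi> v = p" "\<pi> z = g p" by (auto simp: Z_def)
        then show "\<exists>vz. vz \<in> X \<and> c (fst vz) (snd vz) = 0 \<and> \<pi> (fst vz) = p \<and> \<pi> (snd vz) = g p"
          by (intro exI[of _ "(v, z)"]) auto
      qed
      then obtain a where a: "\<And>p. p \<in> S - {q} \<Longrightarrow>
          a p \<in> X \<and> c (fst (a p)) (snd (a p)) = 0 \<and> \<pi> (fst (a p)) = p \<and> \<pi> (snd (a p)) = g p"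
        by metis
      define e where "e p = (if p = q then e' s else if p \<in> S then fst (a p) else e' p)" for p
      define z where "z p = (if p = q then z' s else if p \<in> S then snd (a p) else z' p)" for p
      have e: "\<forall>p\<in>\<pi> ` V. (e p, z p) \<in> X \<and> \<pi> (e p) = p"
      proof
        fix p assume p: "p \<in> \<pi> ` V"
        consider "p = q" | "p \<in> S - {q}" | "p \<notin> S" by auto
        then show "(e p, z p) \<in> X \<and> \<pi> (e p) = p"
        proof cases
          case 1
          then show ?thesis using ez sP' by (auto simp: e_def z_def q_def)
        next
          case 2
          then show ?thesis using a[of p] by (auto simp: e_def z_def)
        next
          case 3
          then have "p \<in> \<pi>' ` V" "p \<noteq> q" "p \<noteq> s" using p P' q s by auto
          then show ?thesis using ez 3 by (auto simp: e_def z_def \<pi>'_def split: if_splits)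
        qed
      qed
      have zS: "\<pi> (z p) \<in> S" if "p \<in> S - {q}" for p
        using that a[of p] arborescence_arc(2)[OF g that] q by (auto simp: z_def)
      have zV: "z p \<in> insert r V" if "p \<in> \<pi> ` V" for p using e that X by blast
      have arb: "arborescence (\<pi> ` V) r UNIV (\<lambda>p. \<pi> (z p))"
      proof (rule arborescenceI)
        fix p assume "p \<in> \<pi> ` V"
        then show "\<pi> (z p) \<in> insert r (\<pi> ` V)" using zV[of p] pr by auto
      next
        fix T x assume T: "T \<subseteq> \<pi> ` V" "x \<in> T" and cl: "\<And>p. p \<in> T \<Longrightarrow> \<pi> (z p) \<in> T"
        \<comment> \<open>Translates a closed set of old labels into a closed set of new ones. If it
          touches \<open>S\<close> it contains \<open>q\<close>, whose exit is that of the merged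
          block \<open>s\<close>.\<close>
        let ?T = "if T \<inter> S = {} then T else insert s (T - S)"
        have qT: "q \<in> T" if "T \<inter> S \<noteq> {}"
        proof (rule ccontr)
          assume q': "q \<notin> T"
          have "T \<inter> S = {}"
          proof (rule arborescence_closed_empty[OF g])
            fix p assume p: "p \<in> T \<inter> S"
            then have "p \<in> S - {q}" using q' by auto
            then have "\<pi> (z p) = g p" using a[of p] by (auto simp: z_def)
            then show "g p \<in> T \<inter> S" using cl[of p] zS[of p] p q' by auto
          qed (use q' in auto)
          then show False using that by simp
        qed
        have "?T = {}"
        proof (rule arborescence_closed_empty[OF arb'])
          show "?T \<subseteq> \<pi>' ` V" using T P' by auto
          fix p assume p: "p \<in> ?T"
          show "\<pi>' (z' p) \<in> ?T"
          proof (cases "p = s")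
            case True
            then have "T \<inter> S \<noteq> {}" using p s by (auto split: if_splits)
            moreover have "\<pi> (z' s) \<in> T" using cl[OF qT[OF calculation]] by (simp add: z_def)
            ultimately show ?thesis using True by (auto simp: \<pi>'_def)
          next
            case False
            then have p': "p \<in> T" "p \<notin> S" using p by (auto split: if_splits)
            then have "\<pi> (z' p) \<in> T" using cl[of p] q by (auto simp: z_def split: if_splits)
            then show ?thesis by (auto simp: \<pi>'_def)
          qed
        qed
        then show False using T by (auto split: if_splits)
      qed auto
      obtain t where t: "arborescence V r X t" "\<forall>p\<in>\<pi> ` V. t (e p) = z p"
        "\<forall>v\<in>V. v \<noteq> e (\<pi> v) \<longrightarrow> \<pi> (t v) = \<pi> v"
        "(\<Sum>v\<in>V. w v (t v)) = K + (\<Sum>p\<in>\<pi> ` V. c (e p) (z p))"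
        using reduction_extend[OF red e arb] by blast
      have "t (e' p) = z' p" if p: "p \<in> \<pi>' ` V" for p
      proof (cases "p = s")
        case True
        have "q \<in> \<pi> ` V" using q S by auto
        then show ?thesis using t(2)[rule_format, of q] True by (simp add: e_def z_def)
      next
        case False
        then have "p \<in> \<pi> ` V" "p \<notin> S" "p \<noteq> q" using p P' q by auto
        then show ?thesis using t(2)[rule_format, of p] by (simp add: e_def z_def)
      qed
      moreover have "\<pi>' (t v) = \<pi>' v" if v: "v \<in> V" "v \<noteq> e' (\<pi>' v)" for v
      proof (cases "v = e (\<pi> v)")
        case False
        then show ?thesis using t(3) v by (simp add: \<pi>'_def)
      next
        case True
        have "\<pi> v \<in> S - {q}"
        proof (rule ccontr)
          assume "\<pi> v \<notin> S - {q}"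
          then consider "\<pi> v = q" | "\<pi> v \<notin> S" by blast
          then have "e (\<pi> v) = e' (\<pi>' v)"
          proof cases
            case 1
            then have "\<pi>' v = s" using q by (simp add: \<pi>'_def)
            then show ?thesis using 1 by (simp add: e_def)
          next
            case 2
            then have "\<pi>' v = \<pi> v" "\<pi> v \<noteq> q" using q by (auto simp: \<pi>'_def)
            then show ?thesis using 2 by (simp add: e_def)
          qed
          then show False using True v(2) by metis
        qed
        moreover have "t v = z (\<pi> v)" using True t(2) v by (metis imageI)
        ultimately show ?thesis using zS[of "\<pi> v"] by (auto simp: \<pi>'_def)
      qed
      moreover have "K + (\<Sum>p\<in>\<pi> ` V. c (e p) (z p)) = K + \<delta> + (\<Sum>p\<in>\<pi>' ` V. c' (e' p) (z' p))"
      proof -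
        have "(\<Sum>p\<in>\<pi> ` V. c (e p) (z p)) = (\<Sum>p\<in>\<pi> ` V - S. c (e p) (z p)) + (\<Sum>p\<in>S. c (e p) (z p))"
          using S fin by (simp add: sum.subset_diff)
        also have "(\<Sum>p\<in>S. c (e p) (z p)) = c (e q) (z q) + (\<Sum>p\<in>S - {q}. c (e p) (z p))"
          using q finS by (simp add: sum.remove)
        also have "(\<Sum>p\<in>S - {q}. c (e p) (z p)) = 0"
          using a by (intro sum.neutral) (auto simp: e_def z_def)
        also have "c (e q) (z q) = \<delta> + c' (e' s) (z' s)"
        proof -
          have "\<pi>' (z' s) \<noteq> s"
            using arborescence_no_loop[OF arb' sP'] .
          then have "(e' s, z' s) \<in> L" using ez sP' q by (auto simp: L_def q_def \<pi>'_def)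
          then show ?thesis by (simp add: e_def z_def c'_def)
        qed
        also have "(\<Sum>p\<in>\<pi> ` V - S. c (e p) (z p)) = (\<Sum>p\<in>\<pi> ` V - S. c' (e' p) (z' p))"
        proof (rule sum.cong[OF refl])
          fix p assume p: "p \<in> \<pi> ` V - S"
          then have "\<pi> (e p) \<notin> S" using e by auto
          moreover have "e p = e' p" "z p = z' p" using p q by (auto simp: e_def z_def)
          ultimately show "c (e p) (z p) = c' (e' p) (z' p)" by (auto simp: c'_def L_def)
        qed
        finally show ?thesis using P' s fin by simp
      qed
      ultimately show "\<exists>t. arborescence V r X t \<and> (\<forall>p\<in>\<pi>' ` V. t (e' p) = z' p)
             \<and> (\<forall>v\<in>V. v \<noteq> e' (\<pi>' v) \<longrightarrow> \<pi>' (t v) = \<pi>' v)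
             \<and> (\<Sum>v\<in>V. w v (t v)) = K + \<delta> + (\<Sum>p\<in>\<pi>' ` V. c' (e' p) (z' p))"
        using t(1,4) by (intro exI[of _ t]) auto
    qed
  qed
  ultimately show ?thesis by blast
qed

text \<open>The vertex \<open>e p\<close> is the only one whose arc leaves the block labelled \<open>p\<close>.\<close>

definition projects :: "'b set \<Rightarrow> ('b \<Rightarrow> 'b) \<Rightarrow> ('b \<Rightarrow> 'b) \<Rightarrow> ('b \<Rightarrow> 'b) \<Rightarrow> bool" where
  "projects V \<pi> t g \<longleftrightarrow> (\<exists>e. (\<forall>p\<in>\<pi> ` V. e p \<in> V \<and> \<pi> (e p) = p \<and> \<pi> (t (e p)) = g p)
     \<and> (\<forall>v\<in>V. v \<noteq> e (\<pi> v) \<longrightarrow> \<pi> (t v) = \<pi> v))"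

text \<open>Take a reduction with the fewest blocks. No nonempty set of blocks is then closed under
  zero-cost arcs, since a smallest such set could be merged. Hence the zero-cost arcs carry an
  arborescence of blocks and the bound \<open>K\<close> is attained; equality in the bound forces
  zero-cost exits, one per block.\<close>

lemma optimal_structure:
  fixes w :: "'b \<Rightarrow> 'b \<Rightarrow> real"
  assumes fin: "finite V" and r: "r \<notin> V" and X: "X \<subseteq> V \<times> insert r V" "\<And>v. (v, v) \<notin> X"
    and Xr: "V \<times> {r} \<subseteq> X"
  shows "\<exists>\<pi> Z K. \<pi> r = r \<and> \<pi> ` V \<subseteq> V \<and> Z \<subseteq> \<pi> ` V \<times> insert r (\<pi> ` V)
    \<and> (\<exists>g. arborescence (\<pi> ` V) r Z g)
    \<and> (\<forall>t. arborescence V r X t \<longrightarrow> K \<le> (\<Sum>v\<in>V. w v (t v)))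
    \<and> (\<forall>t. arborescence V r X t \<longrightarrow> (\<Sum>v\<in>V. w v (t v)) = K \<longrightarrow>
         (\<exists>g. arborescence (\<pi> ` V) r Z g \<and> projects V \<pi> t g))
    \<and> (\<forall>g. arborescence (\<pi> ` V) r Z g \<longrightarrow>
         (\<exists>t. arborescence V r X t \<and> (\<Sum>v\<in>V. w v (t v)) = K \<and> projects V \<pi> t g))"
proof -
  obtain \<pi> c K where red: "reduction V r X w \<pi> c K"
    and least: "\<And>\<pi>' c' K'. reduction V r X w \<pi>' c' K' \<Longrightarrow> card (\<pi> ` V) \<le> card (\<pi>' ` V)"
  proof -
    obtain \<pi>0 where "\<exists>c K. reduction V r X w \<pi>0 c K"
      using reduction_initial[OF fin r X Xr] by blast
    from ex_has_least_nat[of "\<lambda>\<pi>. \<exists>c K. reduction V r X w \<pi> c K", OF this, of "\<lambda>\<pi>. card (\<pi> ` V)"]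
    show ?thesis using that by blast
  qed
  have pr: "\<pi> r = r" and pV: "\<pi> ` V \<subseteq> V" and c0: "\<And>v z. (v, z) \<in> X \<Longrightarrow> 0 \<le> c v z"
    using red unfolding reduction_def by auto
  have rP: "r \<notin> \<pi> ` V" using pV r by auto
  have finP: "finite (\<pi> ` V)" using fin by auto
  define Z where "Z = {(\<pi> v, \<pi> z) |v z. (v, z) \<in> X \<and> c v z = 0}"
  have ZP: "Z \<subseteq> \<pi> ` V \<times> insert r (\<pi> ` V)" using X(1) pr by (auto simp: Z_def)
  have cut: "\<exists>v\<in>S. \<exists>z\<in>insert r (\<pi> ` V) - S. (v, z) \<in> Z" if S: "S \<subseteq> \<pi> ` V" "S \<noteq> {}" for S
  proof (rule ccontr)
    assume no: "\<not> ?thesis"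
    define cl where "cl S \<longleftrightarrow> S \<subseteq> \<pi> ` V \<and> S \<noteq> {} \<and> (\<forall>(v, z)\<in>Z. v \<in> S \<longrightarrow> z \<in> S)" for S
    have "cl S" using no S ZP unfolding cl_def by blast
    from ex_has_least_nat[of cl, OF this, of card]
    obtain T where T: "cl T" "\<And>T'. cl T' \<Longrightarrow> card T \<le> card T'" by blast
    have finT: "finite T" using T(1) finP finite_subset by (auto simp: cl_def)
    have "\<exists>\<pi>' c' K'. reduction V r X w \<pi>' c' K' \<and> card (\<pi>' ` V) < card (\<pi> ` V)"
    proof (rule reduction_merge[OF fin r X(1) Xr red])
      show "T \<subseteq> \<pi> ` V" "T \<noteq> {}" using T(1) by (auto simp: cl_def)
    next
      fix v z assume vz: "(v, z) \<in> X" "\<pi> v \<in> T" "c v z = 0"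
      then have "(\<pi> v, \<pi> z) \<in> Z" by (auto simp: Z_def)
      then show "\<pi> z \<in> T" using T(1) vz(2) unfolding cl_def by blast
    next
      fix T' assume T': "T' \<subset> T" "T' \<noteq> {}"
      then have "card T' < card T" using psubset_card_mono[OF finT] by simp
      then have "\<not> cl T'" using T(2)[of T'] by linarith
      moreover have "T' \<subseteq> \<pi> ` V" using T' T(1) by (auto simp: cl_def)
      ultimately obtain p q where pq: "(p, q) \<in> Z" "p \<in> T'" "q \<notin> T'" using T'(2) unfolding cl_def by blast
      then obtain v z where "(v, z) \<in> X" "c v z = 0" "p = \<pi> v" "q = \<pi> z" by (auto simp: Z_def)
      then show "\<exists>(v, z)\<in>X. \<pi> v \<in> T' \<and> c v z = 0 \<and> \<pi> z \<notin> T'"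
        using pq by (intro bexI[of _ "(v, z)"]) auto
    qed
    then show False using least by (meson not_le)
  qed
  have nonempty: "\<exists>g. arborescence (\<pi> ` V) r Z g"
    using arborescence_exists[OF finP rP cut] .
  have bound: "K + (\<Sum>v | v \<in> V \<and> \<pi> (t v) \<noteq> \<pi> v. c v (t v)) \<le> (\<Sum>v\<in>V. w v (t v))"
      "0 \<le> (\<Sum>v | v \<in> V \<and> \<pi> (t v) \<noteq> \<pi> v. c v (t v))"
    if t: "arborescence V r X t" for t
  proof -
    show "K + (\<Sum>v | v \<in> V \<and> \<pi> (t v) \<noteq> \<pi> v. c v (t v)) \<le> (\<Sum>v\<in>V. w v (t v))"
      using red t unfolding reduction_def by blast
    show "0 \<le> (\<Sum>v | v \<in> V \<and> \<pi> (t v) \<noteq> \<pi> v. c v (t v))"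
      using c0 arborescence_arc(1)[OF t] by (intro sum_nonneg) auto
  qed
  have down: "\<exists>g. arborescence (\<pi> ` V) r Z g \<and> projects V \<pi> t g"
    if t: "arborescence V r X t" and opt: "(\<Sum>v\<in>V. w v (t v)) = K" for t
  proof -
    let ?M = "{v \<in> V. \<pi> (t v) \<noteq> \<pi> v}"
    have s0: "(\<Sum>v\<in>?M. c v (t v)) = 0" using bound[OF t] opt by linarith
    then have inj: "inj_on \<pi> ?M" using red t opt unfolding reduction_def by simp
    have zero: "c v (t v) = 0" if "v \<in> ?M" for v
      using s0 that fin c0 arborescence_arc(1)[OF t] by (subst (asm) sum_nonneg_eq_0_iff) auto
    have "\<forall>p\<in>\<pi> ` V. \<exists>v. v \<in> ?M \<and> \<pi> v = p"
    proof (rule ballI, rule ccontr)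
      fix p assume p: "p \<in> \<pi> ` V" and no: "\<not> (\<exists>v. v \<in> ?M \<and> \<pi> v = p)"
      have "{v \<in> V. \<pi> v = p} = {}"
      proof (rule arborescence_closed_empty[OF t])
        fix v assume v: "v \<in> {v \<in> V. \<pi> v = p}"
        then have *: "\<pi> (t v) = p" using no by auto
        then have "t v \<noteq> r" using p pr rP by metis
        then show "t v \<in> {v \<in> V. \<pi> v = p}"
          using v * arborescence_arc(2)[OF t, of v] by auto
      qed auto
      then show False using p by auto
    qed
    then obtain e where e: "\<And>p. p \<in> \<pi> ` V \<Longrightarrow> e p \<in> ?M \<and> \<pi> (e p) = p" by metis
    have stay: "\<pi> (t v) = \<pi> v" if "v \<in> V" "v \<noteq> e (\<pi> v)" for v
    proof (rule ccontr)
      assume "\<pi> (t v) \<noteq> \<pi> v"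
      then have "v \<in> ?M" using that by auto
      then show False using that e[of "\<pi> v"] inj_onD[OF inj, of v "e (\<pi> v)"] by auto
    qed
    have "projects V \<pi> t (\<lambda>p. \<pi> (t (e p)))"
      unfolding projects_def using e stay by (intro exI[of _ e]) blast
    moreover have "arborescence (\<pi> ` V) r Z (\<lambda>p. \<pi> (t (e p)))"
    proof (rule arborescenceI)
      fix p assume p: "p \<in> \<pi> ` V"
      have *: "(e p, t (e p)) \<in> X" using e[OF p] arborescence_arc(1)[OF t] by auto
      moreover have "c (e p) (t (e p)) = 0" using e[OF p] zero[of "e p"] by auto
      ultimately have "(\<pi> (e p), \<pi> (t (e p))) \<in> Z" unfolding Z_def by blast
      then show "(p, \<pi> (t (e p))) \<in> Z" using e[OF p] by simp
      then show "\<pi> (t (e p)) \<in> insert r (\<pi> ` V)" using ZP by auto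
    next
      fix S x assume S: "S \<subseteq> \<pi> ` V" "x \<in> S" "\<And>p. p \<in> S \<Longrightarrow> \<pi> (t (e p)) \<in> S"
      have "{v \<in> V. \<pi> v \<in> S} = {}"
      proof (rule arborescence_closed_empty[OF t])
        fix v assume v: "v \<in> {v \<in> V. \<pi> v \<in> S}"
        have "\<pi> (t v) \<in> S"
        proof (cases "v = e (\<pi> v)")
          case True
          then show ?thesis using S(3)[of "\<pi> v"] v by (metis (no_types, lifting) mem_Collect_eq)
        next
          case False
          then show ?thesis using stay[of v] v by auto
        qed
        moreover have "t v \<noteq> r" using calculation S(1) pr rP by (metis subsetD)
        ultimately show "t v \<in> {v \<in> V. \<pi> v \<in> S}"
          using v arborescence_arc(2)[OF t, of v] by auto
      qed auto
      then show False using S by auto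
    qed
    ultimately show ?thesis by blast
  qed
  have up: "\<exists>t. arborescence V r X t \<and> (\<Sum>v\<in>V. w v (t v)) = K \<and> projects V \<pi> t g"
    if g: "arborescence (\<pi> ` V) r Z g" for g
  proof -
    have "\<forall>p\<in>\<pi> ` V. \<exists>v z. (v, z) \<in> X \<and> c v z = 0 \<and> \<pi> v = p \<and> \<pi> z = g p"
    proof
      fix p assume "p \<in> \<pi> ` V"
      then have "(p, g p) \<in> Z" using arborescence_arc(1)[OF g] by auto
      then obtain v z where "(v, z) \<in> X" "c v z = 0" "\<pi> v = p" "\<pi> z = g p" by (auto simp: Z_def)
      then show "\<exists>v z. (v, z) \<in> X \<and> c v z = 0 \<and> \<pi> v = p \<and> \<pi> z = g p" by blast
    qed
    then obtain e z where ez: "\<And>p. p \<in> \<pi> ` V \<Longrightarrow>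
        (e p, z p) \<in> X \<and> c (e p) (z p) = 0 \<and> \<pi> (e p) = p \<and> \<pi> (z p) = g p" by metis
    have arb: "arborescence (\<pi> ` V) r UNIV (\<lambda>p. \<pi> (z p))"
    proof (rule arborescenceI)
      fix S x assume S: "S \<subseteq> \<pi> ` V" "x \<in> S" "\<And>p. p \<in> S \<Longrightarrow> \<pi> (z p) \<in> S"
      have "S = {}"
      proof (rule arborescence_closed_empty[OF g S(1)])
        fix p assume "p \<in> S"
        then show "g p \<in> S" using S(1) S(3)[of p] ez[of p] by auto
      qed
      then show False using S by auto
    qed (use ez arborescence_arc(2)[OF g] in auto)
    have "\<forall>p\<in>\<pi> ` V. (e p, z p) \<in> X \<and> \<pi> (e p) = p" using ez by blast
    from reduction_extend[OF red this arb] obtain t where t: "arborescence V r X t" "\<forall>p\<in>\<pi> ` V. t (e p) = z p"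
      "\<forall>v\<in>V. v \<noteq> e (\<pi> v) \<longrightarrow> \<pi> (t v) = \<pi> v"
      "(\<Sum>v\<in>V. w v (t v)) = K + (\<Sum>p\<in>\<pi> ` V. c (e p) (z p))"
      by blast
    have "e p \<in> V" if "p \<in> \<pi> ` V" for p using ez[OF that] X(1) by auto
    then have "projects V \<pi> t g"
      unfolding projects_def using t ez by (intro exI[of _ e]) auto
    moreover have "(\<Sum>p\<in>\<pi> ` V. c (e p) (z p)) = 0" using ez by (intro sum.neutral) auto
    ultimately show ?thesis using t by auto
  qed
  have "K \<le> (\<Sum>v\<in>V. w v (t v))" if "arborescence V r X t" for t
    using bound[OF that] by linarith
  then show ?thesis
    using pr pV ZP nonempty down up by (intro exI[of _ \<pi>] exI[of _ Z] exI[of _ K]) simp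
qed

section \<open>Arborescences of minimal cost with a prescribed number of roots\<close>

text \<open>No vertex of \<open>V\<close> shares the label of \<open>r\<close>, so an arc to
  \<open>r\<close> leaves the block of its tail and must start at the unique exit of that
  block.\<close>

lemma projects_card_roots:
  assumes r: "r \<notin> V" and pi: "\<pi> r = r" "\<pi> ` V \<subseteq> V"
    and t: "arborescence V r X t" and proj: "projects V \<pi> t g"
  shows "card {v \<in> V. t v = r} = card {p \<in> \<pi> ` V. g p = r}"
proof -
  obtain e where e: "\<And>p. p \<in> \<pi> ` V \<Longrightarrow> e p \<in> V \<and> \<pi> (e p) = p \<and> \<pi> (t (e p)) = g p"
    "\<And>v. v \<in> V \<Longrightarrow> v \<noteq> e (\<pi> v) \<Longrightarrow> \<pi> (t v) = \<pi> v"
    using proj unfolding projects_def by blast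
  have exit: "e (\<pi> v) = v" if "v \<in> V" "t v = r" for v
  proof (rule ccontr)
    assume "e (\<pi> v) \<noteq> v"
    then have "\<pi> v = r" using e(2)[of v] that pi by metis
    then show False using that pi r by auto
  qed
  have "bij_betw e {p \<in> \<pi> ` V. g p = r} {v \<in> V. t v = r}"
  proof (rule bij_betw_byWitness[where f' = \<pi>])
    show "e ` {p \<in> \<pi> ` V. g p = r} \<subseteq> {v \<in> V. t v = r}"
    proof (rule image_subsetI)
      fix p assume p: "p \<in> {p \<in> \<pi> ` V. g p = r}"
      then have "e p \<in> V" "\<pi> (t (e p)) = r" using e(1)[of p] by auto
      moreover have "t (e p) \<in> insert r V" using arborescence_arc(2)[OF t \<open>e p \<in> V\<close>] .
      ultimately show "e p \<in> {v \<in> V. t v = r}" using pi(2) r by auto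
    qed
    show "\<pi> ` {v \<in> V. t v = r} \<subseteq> {p \<in> \<pi> ` V. g p = r}"
    proof (rule image_subsetI)
      fix v assume v: "v \<in> {v \<in> V. t v = r}"
      then have "\<pi> (t (e (\<pi> v))) = g (\<pi> v)" using e(1)[of "\<pi> v"] by auto
      moreover have "t (e (\<pi> v)) = r" using v exit[of v] by simp
      ultimately show "\<pi> v \<in> {p \<in> \<pi> ` V. g p = r}" using v pi by auto
    qed
    show "\<forall>p\<in>{p \<in> \<pi> ` V. g p = r}. \<pi> (e p) = p" using e(1) by auto
    show "\<forall>v\<in>{v \<in> V. t v = r}. e (\<pi> v) = v"
      using exit by simp
  qed
  then show ?thesis using bij_betw_same_card by fastforce
qed

text \<open>A walk cannot stay in a block forever, so it passes the exit of every block it visits.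
  Thus \<open>\<pi>\<close> maps walks onto walks, and two walks visiting a common block meet at its
  exit.\<close>

lemma projects_joined:
  assumes r: "r \<notin> V" and pi: "\<pi> r = r" "\<pi> ` V \<subseteq> V"
    and t: "arborescence V r X t" and proj: "projects V \<pi> t g" and xy: "x \<in> V" "y \<in> V"
  shows "joined V t x y \<longleftrightarrow> joined (\<pi> ` V) g (\<pi> x) (\<pi> y)"
proof -
  obtain e where e: "\<And>p. p \<in> \<pi> ` V \<Longrightarrow> e p \<in> V \<and> \<pi> (e p) = p \<and> \<pi> (t (e p)) = g p"
    "\<And>v. v \<in> V \<Longrightarrow> v \<noteq> e (\<pi> v) \<Longrightarrow> \<pi> (t v) = \<pi> v"
    using proj unfolding projects_def by blast
  have rP: "r \<notin> \<pi> ` V" using pi r by auto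
  have reach: "e (\<pi> x) \<in> orbit V t x" if x: "x \<in> V" for x
  proof (rule ccontr)
    assume no: "e (\<pi> x) \<notin> orbit V t x"
    have "{y \<in> V. y \<in> orbit V t x \<and> \<pi> y = \<pi> x} = {}"
    proof (rule arborescence_closed_empty[OF t])
      fix y assume y: "y \<in> {y \<in> V. y \<in> orbit V t x \<and> \<pi> y = \<pi> x}"
      then have "\<pi> (t y) = \<pi> x" using e(2)[of y] no by auto
      moreover have "t y \<noteq> r" using calculation x pi r by auto
      ultimately show "t y \<in> {y \<in> V. y \<in> orbit V t x \<and> \<pi> y = \<pi> x}"
        using y arborescence_arc(2)[OF t, of y] orbit.step[of y V t x] by auto
    qed auto
    then show False using x orbit.start[of x V t] by auto
  qed
  have sub: "\<pi> ` orbit V t x \<subseteq> orbit (\<pi> ` V) g (\<pi> x)" if x: "x \<in> V" for x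
  proof -
    have "orbit V t x \<subseteq> {y. \<pi> y \<in> orbit (\<pi> ` V) g (\<pi> x)}"
    proof (rule orbit_subset_closed)
      show "x \<in> {y. \<pi> y \<in> orbit (\<pi> ` V) g (\<pi> x)}" by (simp add: orbit.start)
      fix y assume y: "y \<in> {y. \<pi> y \<in> orbit (\<pi> ` V) g (\<pi> x)}" "y \<in> V"
      show "t y \<in> {y. \<pi> y \<in> orbit (\<pi> ` V) g (\<pi> x)}"
      proof (cases "y = e (\<pi> y)")
        case True
        then have "\<pi> (t y) = g (\<pi> y)" using e(1)[OF imageI[OF y(2)]] by metis
        then show ?thesis using y orbit.step[of "\<pi> y" "\<pi> ` V" g "\<pi> x"] by auto
      next
        case False
        then show ?thesis using e(2)[of y] y by auto
      qed
    qed
    then show ?thesis by auto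
  qed
  have sup: "orbit (\<pi> ` V) g (\<pi> x) \<subseteq> \<pi> ` orbit V t x" if x: "x \<in> V" for x
  proof (rule orbit_subset_closed)
    show "\<pi> x \<in> \<pi> ` orbit V t x" by (simp add: orbit.start)
    fix p assume p: "p \<in> \<pi> ` orbit V t x" "p \<in> \<pi> ` V"
    then obtain y where y: "y \<in> orbit V t x" "p = \<pi> y" by auto
    then have "y \<noteq> r" using p(2) pi rP by metis
    then have "y \<in> V" using orbit_subset[OF t x] y by auto
    then have "e p \<in> orbit V t x" using reach[of y] y orbit_trans by metis
    then have "t (e p) \<in> orbit V t x" using e(1)[OF p(2)] orbit.step by metis
    then show "g p \<in> \<pi> ` orbit V t x" using e(1)[OF p(2)] by force
  qed
  show ?thesis
  proof
    assume "joined V t x y"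
    then obtain a where "a \<in> orbit V t x" "a \<in> orbit V t y" "a \<in> V" by (auto simp: joined_def)
    then have "\<pi> a \<in> orbit (\<pi> ` V) g (\<pi> x) \<inter> orbit (\<pi> ` V) g (\<pi> y) \<inter> \<pi> ` V"
      using sub[OF xy(1)] sub[OF xy(2)] by auto
    then show "joined (\<pi> ` V) g (\<pi> x) (\<pi> y)" unfolding joined_def by blast
  next
    assume "joined (\<pi> ` V) g (\<pi> x) (\<pi> y)"
    then obtain p where p: "p \<in> orbit (\<pi> ` V) g (\<pi> x)" "p \<in> orbit (\<pi> ` V) g (\<pi> y)" "p \<in> \<pi> ` V"
      by (auto simp: joined_def)
    obtain a where a: "a \<in> orbit V t x" "p = \<pi> a" using sup[OF xy(1)] p(1) by blast
    obtain b where b: "b \<in> orbit V t y" "p = \<pi> b" using sup[OF xy(2)] p(2) by blast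
    have "a \<noteq> r" "b \<noteq> r" using a b p(3) pi rP by metis+
    then have ab: "a \<in> V" "b \<in> V"
      using orbit_subset[OF t xy(1)] orbit_subset[OF t xy(2)] a b by auto
    then have "e p \<in> orbit V t x" using reach[of a] a orbit_trans by metis
    moreover have "e p \<in> orbit V t y" using ab reach[of b] b orbit_trans by metis
    ultimately show "joined V t x y" using e(1)[OF p(3)] unfolding joined_def by blast
  qed
qed

text \<open>Charging \<open>l\<close> per root makes some number of roots in \<open>I\<close> and some number in \<open>J\<close>
  simultaneously optimal.\<close>

lemma lagrange_multiplier:
  fixes m :: "nat \<Rightarrow> real"
  assumes I: "finite I" "I \<noteq> {}" and J: "finite J" "J \<noteq> {}" and IJ: "\<And>i j. i \<in> I \<Longrightarrow> j \<in> J \<Longrightarrow> i < j"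
  shows "\<exists>l::real. \<exists>a\<in>I. \<exists>b\<in>J. m a + l * a = m b + l * b \<and> (\<forall>j\<in>I \<union> J. m b + l * b \<le> m j + l * j)"
proof -
  \<comment> \<open>The price at which \<open>a\<close> and \<open>b\<close> roots are equally
    expensive; a higher price favours the smaller number \<open>a\<close>.\<close>
  define s where "s a b = (m a - m b) / (real b - real a)" for a b
  have le: "l \<le> s a b \<longleftrightarrow> m b + l * b \<le> m a + l * a" and ge: "s a b \<le> l \<longleftrightarrow> m a + l * a \<le> m b + l * b"
    if "a \<in> I" "b \<in> J" for a b l
    using IJ[OF that] by (auto simp: s_def field_simps)
  \<comment> \<open>The highest price at which \<open>b\<close> is no worse than every number in
    \<open>I\<close>. At the maximum over \<open>J\<close>, the maximising \<open>b\<close> ties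
    with some \<open>a\<close>, while each \<open>j\<close> in \<open>J\<close> is matched or beaten
    by some element of \<open>I\<close>.\<close>
  define h where "h b = Min ((\<lambda>a. s a b) ` I)" for b
  have h_le: "h b \<le> s a b" if "a \<in> I" for a b using that I by (auto simp: h_def)
  have h_ex: "\<exists>a\<in>I. h b = s a b" for b
    using Min_in[of "(\<lambda>a. s a b) ` I"] I unfolding h_def by blast
  have "Max (h ` J) \<in> h ` J" using J by (intro Max_in) auto
  then obtain b where b: "b \<in> J" "Max (h ` J) = h b" by blast
  obtain a where a: "a \<in> I" "h b = s a b" using h_ex by blast
  have eq: "m a + h b * a = m b + h b * b"
    using le[OF a(1) b(1), of "h b"] ge[OF a(1) b(1), of "h b"] a by auto
  have I': "m b + h b * b \<le> m j + h b * j" if "j \<in> I" for j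
    using le[OF that b(1)] h_le[OF that] by auto
  have J': "m b + h b * b \<le> m j + h b * j" if j: "j \<in> J" for j
  proof -
    obtain i where i: "i \<in> I" "h j = s i j" using h_ex by blast
    have "h j \<le> h b" using b(2) j J(1) by (metis Max_ge finite_imageI imageI)
    then have "m i + h b * i \<le> m j + h b * j" using ge[OF i(1) j] i by auto
    then show ?thesis using I'[OF i(1)] by linarith
  qed
  show ?thesis using a(1) b(1) eq I' J' by (intro exI[of _ "h b"] bexI[of _ a] bexI[of _ b]) auto
qed

definition rooted_arborescences :: "'b set \<Rightarrow> 'b \<Rightarrow> ('b \<times> 'b) set \<Rightarrow> nat \<Rightarrow> ('b \<Rightarrow> 'b) set" where
  "rooted_arborescences V r X j = {t. arborescence V r X t \<and> card {v \<in> V. t v = r} = j}"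

definition min_arborescences ::
    "'b set \<Rightarrow> 'b \<Rightarrow> ('b \<times> 'b) set \<Rightarrow> ('b \<Rightarrow> 'b \<Rightarrow> real) \<Rightarrow> nat \<Rightarrow> ('b \<Rightarrow> 'b) set" where
  "min_arborescences V r X w j = {t \<in> rooted_arborescences V r X j.
     \<forall>t'\<in>rooted_arborescences V r X j. (\<Sum>v\<in>V. w v (t v)) \<le> (\<Sum>v\<in>V. w v (t' v))}"

text \<open>Parent functions are arbitrary off \<open>V\<close>, so there may be infinitely many of
  them. Their costs depend only on the set of arcs used, a subset of the finite set
  \<open>X\<close>, and hence take finitely many values.\<close>

lemma min_arborescences_nonempty:
  assumes fin: "finite V" and X: "X \<subseteq> V \<times> insert r V" and ne: "rooted_arborescences V r X j \<noteq> {}"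
  shows "min_arborescences V r X w j \<noteq> {}"
proof -
  let ?cost = "\<lambda>t. \<Sum>v\<in>V. w v (t v)" and ?R = "rooted_arborescences V r X j"
  have "?cost t \<in> (\<lambda>H. \<Sum>(v, z)\<in>H. w v z) ` Pow X" if "t \<in> ?R" for t
  proof -
    have "?cost t = (\<Sum>(v, z)\<in>(\<lambda>v. (v, t v)) ` V. w v z)"
      by (subst sum.reindex) (auto simp: inj_on_def)
    moreover have "(\<lambda>v. (v, t v)) ` V \<in> Pow X"
      using that arborescence_arc(1) by (auto simp: rooted_arborescences_def)
    ultimately show ?thesis by blast
  qed
  moreover have "finite X" using X fin finite_subset by (metis finite_SigmaI finite_insert)
  ultimately have "finite (?cost ` ?R)"
    by (intro finite_subset[of "?cost ` ?R" "(\<lambda>H. \<Sum>(v, z)\<in>H. w v z) ` Pow X"]) auto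
  moreover have "Min (?cost ` ?R) \<in> ?cost ` ?R" using calculation ne by (intro Min_in) auto
  then obtain t where "t \<in> ?R" "Min (?cost ` ?R) = ?cost t" by blast
  ultimately have "t \<in> min_arborescences V r X w j"
    unfolding min_arborescences_def using Min_le by fastforce
  then show ?thesis by blast
qed

text \<open>Splitting the attainable root numbers at \<open>k\<close> gives optima for one common
  price on both sides of the split, possibly with root numbers other than \<open>k\<close> and
  \<open>Suc k\<close>.\<close>

lemma optimal_multiplier:
  fixes w :: "'b \<Rightarrow> 'b \<Rightarrow> real"
  assumes fin: "finite V" and r: "r \<notin> V" and X: "X \<subseteq> V \<times> insert r V"
    and f: "rooted_arborescences V r X k \<noteq> {}" "rooted_arborescences V r X (Suc k) \<noteq> {}"
  defines "cost \<equiv> \<lambda>t (l::real). (\<Sum>v\<in>V. w v (t v)) + l * card {v \<in> V. t v = r}"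
  shows "\<exists>l K s t. arborescence V r X s \<and> card {v \<in> V. s v = r} \<le> k \<and> cost s l = K
     \<and> arborescence V r X t \<and> Suc k \<le> card {v \<in> V. t v = r} \<and> cost t l = K
     \<and> (\<forall>u. arborescence V r X u \<longrightarrow> K \<le> cost u l)"
proof -
  let ?N = "{j. rooted_arborescences V r X j \<noteq> {}}"
  have jle: "j \<le> card V" if "j \<in> ?N" for j
    using that fin by (auto simp: rooted_arborescences_def intro!: card_mono)
  then have "?N \<subseteq> {..card V}" by blast
  then have finN: "finite ?N" using finite_subset by blast
  have "\<forall>j\<in>?N. \<exists>t. t \<in> min_arborescences V r X w j"
    using min_arborescences_nonempty[OF fin X] by blast
  then obtain t where t: "\<And>j. j \<in> ?N \<Longrightarrow> t j \<in> min_arborescences V r X w j" by metis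
  define m where "m j = (\<Sum>v\<in>V. w v (t j v))" for j
  have tj: "arborescence V r X (t j)" "card {v \<in> V. t j v = r} = j"
    "\<And>u. u \<in> rooted_arborescences V r X j \<Longrightarrow> m j \<le> (\<Sum>v\<in>V. w v (u v))" if "j \<in> ?N" for j
    using t[OF that] unfolding min_arborescences_def rooted_arborescences_def m_def by auto
  define I where "I = {j \<in> ?N. j \<le> k}"
  define J where "J = {j \<in> ?N. Suc k \<le> j}"
  have "k \<in> I" "Suc k \<in> J" using f by (auto simp: I_def J_def)
  moreover have "finite I" "finite J" using finN by (auto simp: I_def J_def)
  moreover have "\<And>i j. i \<in> I \<Longrightarrow> j \<in> J \<Longrightarrow> i < j" by (auto simp: I_def J_def)
  ultimately obtain l :: real and a b where ab: "a \<in> I" "b \<in> J" "m a + l * a = m b + l * b"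
    "\<forall>j\<in>I \<union> J. m b + l * b \<le> m j + l * j"
    using lagrange_multiplier[of I J m] by blast
  have aN: "a \<in> ?N" "a \<le> k" and bN: "b \<in> ?N" "Suc k \<le> b" using ab by (auto simp: I_def J_def)
  have "m b + l * b \<le> cost u l" if u: "arborescence V r X u" for u
  proof -
    define j where "j = card {v \<in> V. u v = r}"
    have uj: "u \<in> rooted_arborescences V r X j" using u by (auto simp: rooted_arborescences_def j_def)
    then have jN: "j \<in> ?N" by auto
    then have "j \<in> I \<union> J" by (auto simp: I_def J_def)
    then have "m b + l * b \<le> m j + l * j" using ab by blast
    also have "\<dots> \<le> cost u l" using tj(3)[OF jN uj] by (simp add: cost_def j_def)
    finally show ?thesis .
  qed
  moreover have "cost (t a) l = m b + l * b" "cost (t b) l = m b + l * b"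
    using tj(2)[OF aN(1)] tj(2)[OF bN(1)] ab(3) by (auto simp: cost_def m_def)
  ultimately show ?thesis
    using tj(1,2)[OF aN(1)] tj(1,2)[OF bN(1)] aN(2) bN(2)
    by (intro exI[of _ l] exI[of _ "m b + l * b"] exI[of _ "t a"] exI[of _ "t b"]) auto
qed

text \<open>The weighted form of \<open>class_has_exit\<close>: the optima with \<open>k\<close> and
  with \<open>Suc k\<close> roots project to arborescences of one block digraph, where that lemma
  applies. The exit of the class is the exit vertex of the block found there.\<close>

lemma min_arborescence_class_exit:
  fixes w :: "'b \<Rightarrow> 'b \<Rightarrow> real"
  assumes fin: "finite V" and r: "r \<notin> V" and X: "X \<subseteq> V \<times> insert r V" "\<And>v. (v, v) \<notin> X"
    and Xr: "V \<times> {r} \<subseteq> X"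
    and f: "f \<in> min_arborescences V r X w k" and ne: "rooted_arborescences V r X (Suc k) \<noteq> {}"
    and x: "x \<in> V"
    and E: "E = {y \<in> V. \<forall>t\<in>min_arborescences V r X w (Suc k). joined V t x y}"
  shows "\<exists>d\<in>E. f d \<notin> E \<and> (\<forall>y\<in>E - {d}. f y \<in> E)"
proof -
  have fk: "f \<in> rooted_arborescences V r X k" using f by (auto simp: min_arborescences_def)
  then have fk_ne: "rooted_arborescences V r X k \<noteq> {}" by auto
  from optimal_multiplier[OF fin r X(1) fk_ne ne, of w]
  obtain l K0 :: real and s t where st: "arborescence V r X s" "card {v \<in> V. s v = r} \<le> k"
      "(\<Sum>v\<in>V. w v (s v)) + l * card {v \<in> V. s v = r} = K0"
      "arborescence V r X t" "Suc k \<le> card {v \<in> V. t v = r}"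
      "(\<Sum>v\<in>V. w v (t v)) + l * card {v \<in> V. t v = r} = K0"
      and K0: "\<And>u. arborescence V r X u \<Longrightarrow> K0 \<le> (\<Sum>v\<in>V. w v (u v)) + l * card {v \<in> V. u v = r}"
    by blast
  \<comment> \<open>With the price placed on the arcs into \<open>r\<close>, the priced problem
    becomes a plain minimum-cost arborescence problem.\<close>
  define w' where "w' v z = w v z + (if z = r then l else 0)" for v z
  have w': "(\<Sum>v\<in>V. w' v (u v)) = (\<Sum>v\<in>V. w v (u v)) + l * card {v \<in> V. u v = r}" for u
    unfolding w'_def using fin by (simp add: sum.distrib sum.If_cases Int_def mult.commute)
  from optimal_structure[OF fin r X Xr, of w']
  obtain \<pi> Z K g1 where pi: "\<pi> r = r" "\<pi> ` V \<subseteq> V" and Z: "Z \<subseteq> \<pi> ` V \<times> insert r (\<pi> ` V)"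
    and g1: "arborescence (\<pi> ` V) r Z g1"
    and "\<forall>t. arborescence V r X t \<longrightarrow> K \<le> (\<Sum>v\<in>V. w' v (t v))"
    and "\<forall>t. arborescence V r X t \<longrightarrow> (\<Sum>v\<in>V. w' v (t v)) = K \<longrightarrow>
         (\<exists>g. arborescence (\<pi> ` V) r Z g \<and> projects V \<pi> t g)"
    and "\<forall>g. arborescence (\<pi> ` V) r Z g \<longrightarrow>
         (\<exists>t. arborescence V r X t \<and> (\<Sum>v\<in>V. w' v (t v)) = K \<and> projects V \<pi> t g)"
    by (elim exE conjE)
  note low = this(5)[rule_format] and down = this(6)[rule_format] and up = this(7)[rule_format]
  have "K = K0"
  proof (rule antisym)
    show "K \<le> K0" using low[OF st(1)] st(3) w' by simp
    obtain u where "arborescence V r X u" "(\<Sum>v\<in>V. w' v (u v)) = K" using up[OF g1] by blast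
    then show "K0 \<le> K" using K0[of u] w'[of u] by simp
  qed
  note roots = projects_card_roots[OF r pi]
  note join = projects_joined[OF r pi]
  have rP: "r \<notin> \<pi> ` V" using pi r by auto
  have finP: "finite (\<pi> ` V)" using fin by auto
  obtain g0 where g0: "arborescence (\<pi> ` V) r Z g0" "card {p \<in> \<pi> ` V. g0 p = r} \<le> k"
  proof -
    obtain g where "arborescence (\<pi> ` V) r Z g" "projects V \<pi> s g"
      using down[OF st(1)] st(3) w'[of s] \<open>K = K0\<close> by auto
    then show thesis using that roots[OF st(1)] st(2) by simp
  qed
  have Q: "Suc k \<le> card {p \<in> \<pi> ` V. (p, r) \<in> Z}"
  proof -
    obtain g where g: "arborescence (\<pi> ` V) r Z g" "Suc k \<le> card {p \<in> \<pi> ` V. g p = r}"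
    proof -
      obtain g where "arborescence (\<pi> ` V) r Z g" "projects V \<pi> t g"
        using down[OF st(4)] st(6) w'[of t] \<open>K = K0\<close> by auto
      then show thesis using that roots[OF st(4)] st(5) by simp
    qed
    have "{p \<in> \<pi> ` V. g p = r} \<subseteq> {p \<in> \<pi> ` V. (p, r) \<in> Z}"
      using arborescence_arc(1)[OF g(1)] by auto
    then have "card {p \<in> \<pi> ` V. g p = r} \<le> card {p \<in> \<pi> ` V. (p, r) \<in> Z}"
      using finP by (intro card_mono) auto
    then show ?thesis using g by simp
  qed
  \<comment> \<open>Adding roots to \<open>g0\<close> in the block digraph reaches exactly
    \<open>k\<close> and \<open>Suc k\<close> roots, and every arborescence there lifts to one of
    cost \<open>K\<close>.\<close>
  have attained: "\<exists>u\<in>rooted_arborescences V r X j. (\<Sum>v\<in>V. w' v (u v)) = K" if j: "j \<in> {k, Suc k}" for j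
  proof -
    have "card {p \<in> \<pi> ` V. g0 p = r} \<le> j" "j \<le> card {p \<in> \<pi> ` V. (p, r) \<in> Z}" using j g0 Q by auto
    then obtain g where g: "arborescence (\<pi> ` V) r Z g" "card {p \<in> \<pi> ` V. g p = r} = j"
      using add_roots[OF finP rP g0(1)] by blast
    then obtain u where "arborescence V r X u" "(\<Sum>v\<in>V. w' v (u v)) = K" "projects V \<pi> u g"
      using up by blast
    then show ?thesis using roots[of X u g] g(2) unfolding rooted_arborescences_def by auto
  qed
  \<comment> \<open>For a fixed number of roots the price adds a constant, so minimality under
    \<open>w\<close> amounts to attaining the bound \<open>K\<close> under
    \<open>w'\<close>.\<close>
  have opt: "u \<in> min_arborescences V r X w j \<longleftrightarrow>
      u \<in> rooted_arborescences V r X j \<and> (\<Sum>v\<in>V. w' v (u v)) = K" if j: "j \<in> {k, Suc k}" for u j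
  proof -
    obtain u0 where u0: "u0 \<in> rooted_arborescences V r X j" "(\<Sum>v\<in>V. w' v (u0 v)) = K"
      using attained[OF j] by blast
    have c: "(\<Sum>v\<in>V. w' v (h v)) = (\<Sum>v\<in>V. w v (h v)) + l * j" "K \<le> (\<Sum>v\<in>V. w' v (h v))"
      if "h \<in> rooted_arborescences V r X j" for h
      using that w'[of h] low[of h] by (auto simp: rooted_arborescences_def)
    show ?thesis
    proof
      assume "u \<in> min_arborescences V r X w j"
      then have u: "u \<in> rooted_arborescences V r X j" "(\<Sum>v\<in>V. w v (u v)) \<le> (\<Sum>v\<in>V. w v (u0 v))"
        using u0 by (auto simp: min_arborescences_def)
      then show "u \<in> rooted_arborescences V r X j \<and> (\<Sum>v\<in>V. w' v (u v)) = K"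
        using c[OF u(1)] c[OF u0(1)] u0(2) by linarith
    next
      assume u: "u \<in> rooted_arborescences V r X j \<and> (\<Sum>v\<in>V. w' v (u v)) = K"
      have "(\<Sum>v\<in>V. w v (u v)) \<le> (\<Sum>v\<in>V. w v (h v))" if h: "h \<in> rooted_arborescences V r X j" for h
        using c[OF h] c[of u] u by linarith
      then show "u \<in> min_arborescences V r X w j" using u by (auto simp: min_arborescences_def)
    qed
  qed
  have fK: "arborescence V r X f" "card {v \<in> V. f v = r} = k" "(\<Sum>v\<in>V. w' v (f v)) = K"
    using opt[of k f] f by (auto simp: rooted_arborescences_def)
  obtain g where g: "arborescence (\<pi> ` V) r Z g" "projects V \<pi> f g" using down[OF fK(1,3)] by blast
  have gk: "card {p \<in> \<pi> ` V. g p = r} = k" using roots[OF fK(1) g(2)] fK(2) by simp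
  define D where "D = {p \<in> \<pi> ` V. \<forall>g. arborescence (\<pi> ` V) r Z g \<and>
      card {v \<in> \<pi> ` V. g v = r} = Suc k \<longrightarrow> joined (\<pi> ` V) g (\<pi> x) p}"
  \<comment> \<open>Being joined depends only on the blocks, and optimal arborescences project to
    and lift from the block digraph; so the class is a union of blocks.\<close>
  have ED: "y \<in> E \<longleftrightarrow> \<pi> y \<in> D" if y: "y \<in> V" for y
  proof
    assume yE: "y \<in> E"
    have "joined (\<pi> ` V) h (\<pi> x) (\<pi> y)"
      if h: "arborescence (\<pi> ` V) r Z h" "card {v \<in> \<pi> ` V. h v = r} = Suc k" for h
    proof -
      obtain u where u: "arborescence V r X u" "(\<Sum>v\<in>V. w' v (u v)) = K" "projects V \<pi> u h"
        using up[OF h(1)] by blast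
      then have "u \<in> min_arborescences V r X w (Suc k)"
        using opt[of "Suc k" u] roots[OF u(1,3)] h(2) by (simp add: rooted_arborescences_def)
      then show ?thesis using join[OF u(1,3) x y] yE E by auto
    qed
    then show "\<pi> y \<in> D" using y by (auto simp: D_def)
  next
    assume yD: "\<pi> y \<in> D"
    have "joined V u x y" if "u \<in> min_arborescences V r X w (Suc k)" for u
    proof -
      have u: "arborescence V r X u" "card {v \<in> V. u v = r} = Suc k" "(\<Sum>v\<in>V. w' v (u v)) = K"
        using opt[of "Suc k" u] that by (auto simp: rooted_arborescences_def)
      obtain h where h: "arborescence (\<pi> ` V) r Z h" "projects V \<pi> u h" using down[OF u(1,3)] by blast
      then have "joined (\<pi> ` V) h (\<pi> x) (\<pi> y)"
        using yD roots[OF u(1) h(2)] u(2) by (auto simp: D_def)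
      then show ?thesis using join[OF u(1) h(2) x y] by simp
    qed
    then show "y \<in> E" using E y by auto
  qed
  have "\<pi> x \<in> \<pi> ` V" using x by auto
  then obtain d where d: "d \<in> D" "g d \<notin> D" "\<And>p. p \<in> D - {d} \<Longrightarrow> g p \<in> D"
    using class_has_exit[OF rP finP Z g(1) gk Q _ D_def] by blast
  obtain e where e: "\<And>p. p \<in> \<pi> ` V \<Longrightarrow> e p \<in> V \<and> \<pi> (e p) = p \<and> \<pi> (f (e p)) = g p"
    "\<And>v. v \<in> V \<Longrightarrow> v \<noteq> e (\<pi> v) \<Longrightarrow> \<pi> (f v) = \<pi> v"
    using g(2) unfolding projects_def by blast
  have dP: "d \<in> \<pi> ` V" using d by (auto simp: D_def)
  have DV: "D \<subseteq> \<pi> ` V" by (auto simp: D_def)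
  have fE: "f y \<in> E" if "y \<in> V" "\<pi> (f y) \<in> D" for y
  proof -
    have "f y \<noteq> r" using that pi DV rP by auto
    then have "f y \<in> V" using arborescence_arc(2)[OF fK(1) that(1)] by auto
    then show ?thesis using ED that by auto
  qed
  have "e d \<in> E" using ED[of "e d"] e(1)[OF dP] d(1) by auto
  moreover have "f (e d) \<notin> E"
  proof
    assume "f (e d) \<in> E"
    moreover have "f (e d) \<in> V" using calculation E by auto
    ultimately show False using ED[of "f (e d)"] e(1)[OF dP] d(2) by auto
  qed
  moreover have "f y \<in> E" if y: "y \<in> E - {e d}" for y
  proof -
    have yV: "y \<in> V" using y E by auto
    have yD: "\<pi> y \<in> D" using y ED[OF yV] by auto
    show ?thesis
    proof (cases "y = e (\<pi> y)")
      case True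
      then have "\<pi> y \<noteq> d" using y by (metis DiffD2 singletonI)
      then have "g (\<pi> y) \<in> D" using d(3)[of "\<pi> y"] yD by simp
      moreover have "\<pi> (f y) = g (\<pi> y)" using True e(1)[OF imageI[OF yV]] by metis
      ultimately have "\<pi> (f y) \<in> D" by simp
      then show ?thesis using fE yV by auto
    next
      case False
      then show ?thesis using e(2)[OF yV] yD fE[OF yV] by auto
    qed
  qed
  ultimately show ?thesis by blast
qed

section \<open>Forests as arborescences\<close>

definition parent :: "('a \<times> 'a) set \<Rightarrow> 'a option \<Rightarrow> 'a option" where
  "parent F x = (case x of None \<Rightarrow> None
     | Some i \<Rightarrow> if \<exists>j. (i, j) \<in> F then Some (THE j. (i, j) \<in> F) else None)"

definition parent_arcs :: "'a set \<Rightarrow> ('a option \<Rightarrow> 'a option) \<Rightarrow> ('a \<times> 'a) set" where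
  "parent_arcs N t = {(i, j). i \<in> N \<and> t (Some i) = Some j}"

text \<open>Every vertex may serve as a root, hence all the arcs to \<open>None\<close>. Loops are
  dropped: no forest contains one, and the initial dual solution relies on every arc leaving its
  singleton block.\<close>

definition rooted_arcs :: "'a set \<Rightarrow> ('a \<times> 'a) set \<Rightarrow> ('a option \<times> 'a option) set" where
  "rooted_arcs N A = {(Some i, Some j) |i j. (i, j) \<in> A \<and> i \<noteq> j} \<union> Some ` N \<times> {None}"

definition arc_cost :: "('a \<Rightarrow> 'a \<Rightarrow> real) \<Rightarrow> 'a option \<Rightarrow> 'a option \<Rightarrow> real" where
  "arc_cost v x y = (case (x, y) of (Some i, Some j) \<Rightarrow> v i j | _ \<Rightarrow> 0)"

lemma parent_eq_Some:
  assumes "is_forest N F"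
  shows "parent F (Some i) = Some j \<longleftrightarrow> (i, j) \<in> F"
proof -
  have uniq: "j = l" if "(i, j) \<in> F" "(i, l) \<in> F" for j l
    using assms that unfolding is_forest_def by blast
  have the: "(THE l. (i, l) \<in> F) = m" if "(i, m) \<in> F" for m
    using that uniq by (intro the_equality) auto
  show ?thesis unfolding parent_def using the by auto
qed

lemma parent_arcs_parent:
  assumes "is_forest N F"
  shows "parent_arcs N (parent F) = F"
  using parent_eq_Some[OF assms] assms unfolding parent_arcs_def is_forest_def by auto

lemma arborescence_parent:
  assumes fin: "finite N" and F: "is_forest N F" "F \<subseteq> A"
  shows "arborescence (Some ` N) None (rooted_arcs N A) (parent F)"
proof (rule arborescenceI)
  have FN: "F \<subseteq> N \<times> N" and ac: "acyclic F" using F unfolding is_forest_def acyclic_def by auto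
  fix x assume "x \<in> Some ` N"
  then obtain i where i: "x = Some i" "i \<in> N" by auto
  have ne: "(i, i) \<notin> F" using ac by (auto simp: acyclic_def)
  show "(x, parent F x) \<in> rooted_arcs N A"
  proof (cases "parent F x")
    case None
    then show ?thesis using i by (simp add: rooted_arcs_def)
  next
    case (Some j)
    then have "(i, j) \<in> F" using parent_eq_Some[OF F(1)] i by simp
    then show ?thesis using Some i ne F(2) by (auto simp: rooted_arcs_def)
  qed
  show "parent F x \<in> insert None (Some ` N)"
  proof (cases "parent F x")
    case (Some j)
    then have "(i, j) \<in> F" using parent_eq_Some[OF F(1)] i by simp
    then show ?thesis using Some FN by auto
  qed auto
next
  fix S x assume S: "S \<subseteq> Some ` N" "x \<in> S" "\<And>y. y \<in> S \<Longrightarrow> parent F y \<in> S"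
  have "finite F" "acyclic F"
    using F fin finite_subset[of F "N \<times> N"] unfolding is_forest_def acyclic_def by auto
  then have wf: "wf (F\<inverse>)" by (rule finite_acyclic_wf_converse)
  obtain i0 where "x = Some i0" using S by auto
  then have "i0 \<in> {i. Some i \<in> S}" using S by auto
  then obtain i where i: "i \<in> {i. Some i \<in> S}" "\<And>j. (j, i) \<in> F\<inverse> \<Longrightarrow> j \<notin> {i. Some i \<in> S}"
    using wfE_min[OF wf] by metis
  have "parent F (Some i) \<in> S" using S(3) i by auto
  moreover obtain j where "parent F (Some i) = Some j" using S(1) calculation by auto
  ultimately show False using i(2)[of j] parent_eq_Some[OF F(1)] by auto
qed

context
  fixes N :: "'a set" and A :: "('a \<times> 'a) set" and t :: "'a option \<Rightarrow> 'a option"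
  assumes AN: "A \<subseteq> N \<times> N" and t: "arborescence (Some ` N) None (rooted_arcs N A) t"
begin

lemma orbit_parent_arcs:
  assumes "y \<in> orbit (Some ` N) t (Some i)" "y = Some j"
  shows "(i, j) \<in> (parent_arcs N t)\<^sup>*"
  using assms
proof (induction arbitrary: j)
  case start
  then show ?case by simp
next
  case (step y)
  then obtain l where l: "y = Some l" "l \<in> N" by auto
  then have "(i, l) \<in> (parent_arcs N t)\<^sup>*" "(l, j) \<in> parent_arcs N t"
    using step by (auto simp: parent_arcs_def)
  then show ?case by simp
qed

lemma trancl_parent_arcs:
  assumes "(i, j) \<in> (parent_arcs N t)\<^sup>+"
  shows "Some j \<in> orbit (Some ` N) t (t (Some i))"
  using assms
proof induction
  case (base j)
  then show ?case by (simp add: parent_arcs_def orbit.start)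
next
  case (step j l)
  then show ?case using orbit.step[of "Some j" "Some ` N" t "t (Some i)"] by (auto simp: parent_arcs_def)
qed

lemma parent_arcs_forest: "is_forest N (parent_arcs N t)" "parent_arcs N t \<subseteq> A"
proof -
  show A: "parent_arcs N t \<subseteq> A"
  proof
    fix p assume "p \<in> parent_arcs N t"
    then obtain i j where ij: "p = (i, j)" "i \<in> N" "t (Some i) = Some j" by (auto simp: parent_arcs_def)
    then have "(Some i, Some j) \<in> rooted_arcs N A" using arborescence_arc(1)[OF t, of "Some i"] by auto
    then show "p \<in> A" using ij by (auto simp: rooted_arcs_def)
  qed
  have "(i, i) \<notin> (parent_arcs N t)\<^sup>+" for i
  proof
    assume cyc: "(i, i) \<in> (parent_arcs N t)\<^sup>+"
    then have "i \<in> N" by (auto simp: parent_arcs_def dest: tranclD)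
    then show False using trancl_parent_arcs[OF cyc] arborescence_acyclic[OF t, of "Some i"] by auto
  qed
  then show "is_forest N (parent_arcs N t)"
    using A AN unfolding is_forest_def by (auto simp: parent_arcs_def)
qed

text \<open>With at most one outgoing arc per vertex, weak connection reduces to two directed walks
  that meet: the ends of an arc are joined, and \<open>joined\<close> is symmetric and
  transitive.\<close>

lemma weak_rel_iff_joined:
  "(i, j) \<in> weak_rel N (parent_arcs N t) \<longleftrightarrow> i \<in> N \<and> j \<in> N \<and> joined (Some ` N) t (Some i) (Some j)"
proof
  let ?F = "parent_arcs N t"
  let ?R = "Id_on N \<union> ?F \<union> ?F\<inverse>"
  have arc: "joined (Some ` N) t (Some i) (Some j)" if "(i, j) \<in> ?F" for i j
  proof -
    have ij: "i \<in> N" "j \<in> N" "t (Some i) = Some j"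
      using that parent_arcs_forest(2) AN by (auto simp: parent_arcs_def)
    then have "Some j \<in> orbit (Some ` N) t (Some i)"
      using orbit.step[OF orbit.start, of "Some i" "Some ` N" t] by simp
    then show ?thesis using ij by (intro joined_orbit) auto
  qed
  assume "(i, j) \<in> weak_rel N ?F"
  then have i: "i \<in> N" "j \<in> N" and "(i, j) \<in> ?R\<^sup>*" by (auto simp: weak_rel_def)
  from this(3) have "joined (Some ` N) t (Some i) (Some j)"
  proof induction
    case base
    show ?case using i by (intro joined_orbit orbit.start) auto
  next
    case (step j l)
    then consider "j = l" | "(j, l) \<in> ?F" | "(l, j) \<in> ?F" by auto
    then show ?case
    proof cases
      case 2
      then show ?thesis using step.IH arc joined_trans by metis
    next
      case 3
      then show ?thesis using step.IH arc joined_trans joined_sym by metis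
    qed (use step.IH in simp)
  qed
  then show "i \<in> N \<and> j \<in> N \<and> joined (Some ` N) t (Some i) (Some j)" using i by simp
next
  let ?F = "parent_arcs N t"
  let ?R = "Id_on N \<union> ?F \<union> ?F\<inverse>"
  assume ij: "i \<in> N \<and> j \<in> N \<and> joined (Some ` N) t (Some i) (Some j)"
  then obtain l where l: "Some l \<in> orbit (Some ` N) t (Some i)" "Some l \<in> orbit (Some ` N) t (Some j)"
    by (auto simp: joined_def)
  have "(i, l) \<in> ?F\<^sup>*" "(j, l) \<in> ?F\<^sup>*" using l orbit_parent_arcs by auto
  then have "(i, l) \<in> ?F\<^sup>*" "(l, j) \<in> (?F\<inverse>)\<^sup>*" by (auto simp: rtrancl_converse)
  moreover have "?F\<^sup>* \<subseteq> ?R\<^sup>*" "(?F\<inverse>)\<^sup>* \<subseteq> ?R\<^sup>*" by (auto intro!: rtrancl_mono)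
  ultimately have "(i, j) \<in> ?R\<^sup>*" by (meson rtrancl_trans subsetD)
  then show "(i, j) \<in> weak_rel N ?F" using ij by (auto simp: weak_rel_def)
qed

lemma equiv_weak_rel: "equiv N (weak_rel N (parent_arcs N t))"
proof (rule equivI)
  show "weak_rel N (parent_arcs N t) \<subseteq> N \<times> N" by (auto simp: weak_rel_def)
  show "refl_on N (weak_rel N (parent_arcs N t))"
    by (auto simp: refl_on_def weak_rel_def)
  show "sym (weak_rel N (parent_arcs N t))"
    unfolding sym_def weak_rel_iff_joined using joined_sym by metis
  show "trans (weak_rel N (parent_arcs N t))"
    unfolding trans_def weak_rel_iff_joined using joined_trans by metis
qed

text \<open>Every walk reaches \<open>None\<close> through a root, so each weak class contains a
  root. It contains only one, because the walk of a root has no further vertex.\<close>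

lemma card_trees_parent_arcs:
  "card (trees_of N (parent_arcs N t)) = card {x \<in> Some ` N. t x = None}"
proof -
  let ?W = "weak_rel N (parent_arcs N t)" and ?R = "{i \<in> N. t (Some i) = None}"
  have "bij_betw (\<lambda>i. ?W `` {i}) ?R (N // ?W)"
    unfolding bij_betw_def
  proof
    show "inj_on (\<lambda>i. ?W `` {i}) ?R"
    proof (rule inj_onI)
      fix i j assume ij: "i \<in> ?R" "j \<in> ?R" "?W `` {i} = ?W `` {j}"
      then have "(i, j) \<in> ?W" using eq_equiv_class[OF _ equiv_weak_rel, of i j] by auto
      then have "joined (Some ` N) t (Some i) (Some j)" by (simp add: weak_rel_iff_joined)
      moreover have "orbit (Some ` N) t (Some l) = {Some l, None}" if "l \<in> ?R" for l
        using that orbit_unfold[of "Some l" "Some ` N" t] orbit_outside[of None "Some ` N" t] by auto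
      ultimately show "i = j" using ij unfolding joined_def by auto
    qed
    show "(\<lambda>i. ?W `` {i}) ` ?R = N // ?W"
    proof
      show "(\<lambda>i. ?W `` {i}) ` ?R \<subseteq> N // ?W" by (auto intro: quotientI)
      show "N // ?W \<subseteq> (\<lambda>i. ?W `` {i}) ` ?R"
      proof
        fix T assume "T \<in> N // ?W"
        then obtain i where i: "i \<in> N" "T = ?W `` {i}" by (auto elim: quotientE)
        have "None \<in> orbit (Some ` N) t (Some i)" using root_in_orbit[OF t] i by auto
        then obtain y where y: "y \<in> orbit (Some ` N) t (Some i)" "y \<in> Some ` N" "t y = None"
          by (cases rule: orbit.cases) auto
        then obtain l where l: "y = Some l" "l \<in> ?R" by auto
        then have "(i, l) \<in> ?W" using i y joined_orbit[OF y(1,2)] by (auto simp: weak_rel_iff_joined)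
        then have "T = ?W `` {l}" using i equiv_class_eq[OF equiv_weak_rel] by auto
        then show "T \<in> (\<lambda>i. ?W `` {i}) ` ?R" using l by auto
      qed
    qed
  qed
  then have "card ?R = card (N // ?W)" by (rule bij_betw_same_card)
  moreover have "{x \<in> Some ` N. t x = None} = Some ` ?R" by auto
  then have "card {x \<in> Some ` N. t x = None} = card ?R" by (simp add: card_image)
  ultimately show ?thesis by (simp add: trees_of_def)
qed

end

lemma Upsilon_parent_arcs:
  assumes "finite N"
  shows "Upsilon v (parent_arcs N t) = (\<Sum>x\<in>Some ` N. arc_cost v x (t x))"
proof -
  let ?M = "{i \<in> N. t (Some i) \<noteq> None}"
  have "parent_arcs N t = (\<lambda>i. (i, the (t (Some i)))) ` ?M"
    by (force simp: parent_arcs_def)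
  then have "Upsilon v (parent_arcs N t) = (\<Sum>i\<in>?M. v i (the (t (Some i))))"
    unfolding Upsilon_def by (simp add: sum.reindex inj_on_def)
  also have "\<dots> = (\<Sum>i\<in>?M. arc_cost v (Some i) (t (Some i)))"
    by (intro sum.cong) (auto simp: arc_cost_def)
  also have "\<dots> = (\<Sum>i\<in>N. arc_cost v (Some i) (t (Some i)))"
    using assms by (intro sum.mono_neutral_left) (auto simp: arc_cost_def)
  finally show ?thesis by (simp add: sum.reindex)
qed

section \<open>Atoms of the algebra and the induced subgraph\<close>

lemma forest_algebra_subset: "B \<in> forest_algebra N A v k \<Longrightarrow> B \<subseteq> N"
proof (induction rule: forest_algebra.induct)
  case (gen F T)
  then show ?case by (auto simp: trees_of_def quotient_def weak_rel_def)
qed auto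

text \<open>No member of the algebra separates two vertices that share a tree in every minimal
  forest: this holds for the generators and survives complement and intersection. Conversely, the
  tree of \<open>x\<close> in each minimal forest is a generator meeting the atom, so it contains
  the atom.\<close>

lemma atom_eq_class:
  assumes eq: "\<And>G. G \<in> min_forests N A v k \<Longrightarrow> equiv N (weak_rel N G)"
    and E: "is_atom (forest_algebra N A v k) E" and x: "x \<in> E"
  shows "E = {y \<in> N. \<forall>G\<in>min_forests N A v k. (x, y) \<in> weak_rel N G}"
proof
  have EN: "E \<subseteq> N" using E forest_algebra_subset[of E N A v k] by (simp add: is_atom_def)
  show "E \<subseteq> {y \<in> N. \<forall>G\<in>min_forests N A v k. (x, y) \<in> weak_rel N G}"
  proof
    fix y assume y: "y \<in> E"
    have "(x, y) \<in> weak_rel N G" if G: "G \<in> min_forests N A v k" for G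
    proof -
      let ?T = "weak_rel N G `` {x}"
      have "?T \<in> trees_of N G" using x EN by (auto simp: trees_of_def intro: quotientI)
      then have "?T \<in> forest_algebra N A v k" using G by (intro forest_algebra.gen)
      moreover have "x \<in> E \<inter> ?T" using x EN equiv_class_self[OF eq[OF G]] by auto
      ultimately have "E \<inter> ?T = E" using E unfolding is_atom_def by blast
      then show ?thesis using y by auto
    qed
    then show "y \<in> {y \<in> N. \<forall>G\<in>min_forests N A v k. (x, y) \<in> weak_rel N G}" using y EN by auto
  qed
  show "{y \<in> N. \<forall>G\<in>min_forests N A v k. (x, y) \<in> weak_rel N G} \<subseteq> E"
  proof
    fix y assume y: "y \<in> {y \<in> N. \<forall>G\<in>min_forests N A v k. (x, y) \<in> weak_rel N G}"
    have "x \<in> B \<longleftrightarrow> y \<in> B" if "B \<in> forest_algebra N A v k" for B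
      using that
    proof (induction rule: forest_algebra.induct)
      case (gen F T)
      have "(x, y) \<in> weak_rel N F" using y gen by auto
      then show ?case using gen(2) quotient_eq_iff[OF eq[OF gen(1)]] eq[OF gen(1)]
        unfolding trees_of_def by (metis in_quotient_imp_closed equiv_def symD)
    qed (use x y EN in auto)
    then show "y \<in> E" using E x unfolding is_atom_def by blast
  qed
qed

text \<open>Arcs followed from any vertex of \<open>E\<close> stay in \<open>E\<close> until
  \<open>d\<close> is met, and finiteness with acyclicity ensures that it is met. All of
  \<open>E\<close> is therefore connected through \<open>d\<close>.\<close>

lemma is_tree_single_exit:
  assumes F: "is_forest N F" and EN: "E \<subseteq> N" and fin: "finite N"
    and d: "d \<in> E" and stay: "\<And>i. i \<in> E - {d} \<Longrightarrow> \<exists>j\<in>E. (i, j) \<in> F"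
  shows "is_tree E (induced F E)"
proof -
  let ?H = "induced F E"
  have HF: "?H \<subseteq> F" by (auto simp: induced_def)
  have forest: "is_forest E ?H"
    unfolding is_forest_def
  proof (intro conjI allI impI)
    show "?H \<subseteq> E \<times> E" by (auto simp: induced_def)
    show "j = l" if "(i, j) \<in> ?H \<and> (i, l) \<in> ?H" for i j l
      using that HF F unfolding is_forest_def by blast
    show "(i, i) \<notin> ?H\<^sup>+" for i
      using trancl_mono[OF _ HF] F unfolding is_forest_def by blast
  qed
  have "finite F" "acyclic F"
    using F fin finite_subset[of F "N \<times> N"] unfolding is_forest_def acyclic_def by auto
  then have wf: "wf (F\<inverse>)" by (rule finite_acyclic_wf_converse)
  have reach: "i \<in> E \<longrightarrow> (i, d) \<in> ?H\<^sup>*" for i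
    using wf
  proof (induction i)
    case (less i)
    show ?case
    proof
      assume i: "i \<in> E"
      show "(i, d) \<in> ?H\<^sup>*"
      proof (cases "i = d")
        case False
        then obtain j where j: "j \<in> E" "(i, j) \<in> F" using stay i by auto
        then have "(i, j) \<in> ?H" using i by (auto simp: induced_def)
        moreover have "(j, d) \<in> ?H\<^sup>*" using less j by auto
        ultimately show ?thesis by (rule converse_rtrancl_into_rtrancl)
      qed simp
    qed
  qed
  let ?R = "Id_on E \<union> ?H \<union> ?H\<inverse>"
  have "(i, j) \<in> ?R\<^sup>*" if "i \<in> E" "j \<in> E" for i j
  proof -
    have "(i, d) \<in> ?H\<^sup>*" "(d, j) \<in> (?H\<inverse>)\<^sup>*" using reach that by (auto simp: rtrancl_converse)
    moreover have "?H\<^sup>* \<subseteq> ?R\<^sup>*" "(?H\<inverse>)\<^sup>* \<subseteq> ?R\<^sup>*" by (auto intro!: rtrancl_mono)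
    ultimately show ?thesis by (meson rtrancl_trans subsetD)
  qed
  then have "weak_rel E ?H = E \<times> E" by (auto simp: weak_rel_def)
  then have "trees_of E ?H = {E}" using d by (auto simp: trees_of_def quotient_def)
  then show ?thesis using forest by (simp add: is_tree_def)
qed

theorem theorem6:
  fixes N :: "'a set" and A :: "('a \<times> 'a) set" and v :: "'a \<Rightarrow> 'a \<Rightarrow> real" and k :: nat
  assumes "finite N"
    and "A \<subseteq> N \<times> N"
    and "spanning_forests N A 1 \<noteq> {}"
    and "2 \<le> k" and "k \<le> card N"
    and "F \<in> min_forests N A v (k - 1)"
    and "is_atom (forest_algebra N A v k) E"
  shows "is_tree E (induced F E)"
proof -
  note fin = assms(1) and AN = assms(2)
  let ?V = "Some ` N" and ?X = "rooted_arcs N A" and ?w = "arc_cost v"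
  obtain m where k: "k = Suc m" using assms(4) by (cases k) auto
  have finS: "finite (spanning_forests N A j)" for j
  proof -
    have "spanning_forests N A j \<subseteq> Pow A" by (auto simp: spanning_forests_def)
    moreover have "finite A" using AN fin finite_subset by blast
    ultimately show ?thesis using finite_subset by blast
  qed
  \<comment> \<open>Parent functions are determined only on the vertex set, so forests and
    arborescences are related by two translations, \<open>par\<close> and \<open>arcs\<close>,
    instead of a bijection. Both preserve weight and number of roots, hence minimality.\<close>
  have par: "parent G \<in> rooted_arborescences ?V None ?X j" "parent_arcs N (parent G) = G"
    "Upsilon v G = (\<Sum>x\<in>?V. ?w x (parent G x))" if "G \<in> spanning_forests N A j" for G j
  proof -
    have G: "is_forest N G" "G \<subseteq> A" "card (trees_of N G) = j"
      using that by (auto simp: spanning_forests_def)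
    have arb: "arborescence ?V None ?X (parent G)" using arborescence_parent[OF fin G(1,2)] .
    show arcs: "parent_arcs N (parent G) = G" using parent_arcs_parent[OF G(1)] .
    show "parent G \<in> rooted_arborescences ?V None ?X j"
      using arb card_trees_parent_arcs[OF AN arb] arcs G(3) by (simp add: rooted_arborescences_def)
    show "Upsilon v G = (\<Sum>x\<in>?V. ?w x (parent G x))"
      using Upsilon_parent_arcs[OF fin, of v "parent G"] arcs by simp
  qed
  have arcs: "parent_arcs N t \<in> spanning_forests N A j" if "t \<in> rooted_arborescences ?V None ?X j" for t j
  proof -
    have t: "arborescence ?V None ?X t" using that by (simp add: rooted_arborescences_def)
    show ?thesis using parent_arcs_forest[OF AN t] card_trees_parent_arcs[OF AN t] that
      by (simp add: rooted_arborescences_def spanning_forests_def)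
  qed
  have par_min: "parent G \<in> min_arborescences ?V None ?X ?w j" if "G \<in> min_forests N A v j" for G j
  proof -
    have G: "G \<in> spanning_forests N A j" "Upsilon v G = Min (Upsilon v ` spanning_forests N A j)"
      using that by (auto simp: min_forests_def phi_def)
    have "Upsilon v G \<le> (\<Sum>x\<in>?V. ?w x (t x))" if "t \<in> rooted_arborescences ?V None ?X j" for t
      unfolding G(2) Upsilon_parent_arcs[OF fin, symmetric]
      using arcs[OF that] finS[of j] by (intro Min_le) auto
    then show ?thesis using par[OF G(1)] by (simp add: min_arborescences_def)
  qed
  have arcs_min: "parent_arcs N t \<in> min_forests N A v j" if "t \<in> min_arborescences ?V None ?X ?w j" for t j
  proof -
    have t: "t \<in> rooted_arborescences ?V None ?X j"
      "\<And>u. u \<in> rooted_arborescences ?V None ?X j \<Longrightarrow> (\<Sum>x\<in>?V. ?w x (t x)) \<le> (\<Sum>x\<in>?V. ?w x (u x))"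
      using that by (auto simp: min_arborescences_def)
    have "Upsilon v (parent_arcs N t) \<le> Upsilon v G" if "G \<in> spanning_forests N A j" for G
      using t(2)[OF par(1)[OF that]] par(3)[OF that] Upsilon_parent_arcs[OF fin, of v t] by simp
    then have "Min (Upsilon v ` spanning_forests N A j) = Upsilon v (parent_arcs N t)"
      using arcs[OF t(1)] finS by (intro Min_eqI) auto
    then show ?thesis using arcs[OF t(1)] by (simp add: min_forests_def phi_def)
  qed
  have arb: "arborescence ?V None ?X t" if "t \<in> min_arborescences ?V None ?X ?w j" for t j
    using that by (simp add: min_arborescences_def rooted_arborescences_def)
  have weak: "(i, j) \<in> weak_rel N G \<longleftrightarrow> i \<in> N \<and> j \<in> N \<and> joined ?V (parent G) (Some i) (Some j)"
    and eqv: "equiv N (weak_rel N G)" if "G \<in> min_forests N A v k" for G i j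
  proof -
    have "parent_arcs N (parent G) = G" using that par(2) by (auto simp: min_forests_def)
    then show "(i, j) \<in> weak_rel N G \<longleftrightarrow> i \<in> N \<and> j \<in> N \<and> joined ?V (parent G) (Some i) (Some j)"
      "equiv N (weak_rel N G)"
      using weak_rel_iff_joined[OF AN arb[OF par_min[OF that]], of i j]
        equiv_weak_rel[OF AN arb[OF par_min[OF that]]] by simp_all
  qed
  obtain x where x: "x \<in> E" using assms(7) by (auto simp: is_atom_def)
  have E: "E = {y \<in> N. \<forall>G\<in>min_forests N A v k. (x, y) \<in> weak_rel N G}"
    using atom_eq_class[OF eqv assms(7) x] .
  then have xN: "x \<in> N" using x by auto
  let ?E = "{y \<in> ?V. \<forall>t\<in>min_arborescences ?V None ?X ?w (Suc m). joined ?V t (Some x) y}"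
  have E': "Some ` E = ?E"
  proof
    show "Some ` E \<subseteq> ?E"
    proof (rule image_subsetI)
      fix y assume y: "y \<in> E"
      then have yN: "y \<in> N" using E by auto
      have "joined ?V t (Some x) (Some y)" if "t \<in> min_arborescences ?V None ?X ?w (Suc m)" for t
      proof -
        have "parent_arcs N t \<in> min_forests N A v k" using arcs_min[OF that] k by simp
        then have "(x, y) \<in> weak_rel N (parent_arcs N t)" using y E by blast
        then show ?thesis using weak_rel_iff_joined[OF AN arb[OF that]] by simp
      qed
      then show "Some y \<in> ?E" using yN by simp
    qed
    show "?E \<subseteq> Some ` E"
    proof
      fix z assume z: "z \<in> ?E"
      then obtain y where y: "z = Some y" "y \<in> N" by auto
      have "(x, y) \<in> weak_rel N G" if "G \<in> min_forests N A v k" for G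
        using weak[OF that] par_min[OF that] z y xN k by auto
      then show "z \<in> Some ` E" using y E by auto
    qed
  qed
  have f: "parent F \<in> min_arborescences ?V None ?X ?w m" using par_min[OF assms(6)] k by simp
  have X: "?X \<subseteq> ?V \<times> insert None ?V" "\<And>z. (z, z) \<notin> ?X" "?V \<times> {None} \<subseteq> ?X"
    using AN by (auto simp: rooted_arcs_def)
  \<comment> \<open>\<open>F\<close> can be given one more root, because every vertex has an arc to
    \<open>None\<close> and \<open>k \<le> card N\<close>.\<close>
  have ne: "rooted_arborescences ?V None ?X (Suc m) \<noteq> {}"
  proof -
    have m: "card {y \<in> ?V. parent F y = None} = m"
      using f by (simp add: min_arborescences_def rooted_arborescences_def)
    have "{y \<in> ?V. (y, None) \<in> ?X} = ?V" using X(3) by auto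
    then have "Suc m \<le> card {y \<in> ?V. (y, None) \<in> ?X}"
      using assms(5) k by (simp add: card_image)
    then obtain g where "arborescence ?V None ?X g" "card {y \<in> ?V. g y = None} = Suc m"
      using add_roots[of ?V None ?X "parent F" "Suc m"] fin arb[OF f] m by auto
    then show ?thesis by (auto simp: rooted_arborescences_def)
  qed
  have "finite ?V" "None \<notin> ?V" "Some x \<in> ?V" using fin xN by auto
  from min_arborescence_class_exit[OF this(1,2) X f ne this(3) E']
  obtain d where d: "d \<in> Some ` E" "\<And>y. y \<in> Some ` E - {d} \<Longrightarrow> parent F y \<in> Some ` E"
    by blast
  then obtain i where i: "d = Some i" "i \<in> E" by auto
  have F: "is_forest N F" using assms(6) by (simp add: min_forests_def spanning_forests_def)
  have "\<exists>l\<in>E. (j, l) \<in> F" if "j \<in> E - {i}" for j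
    using d(2)[of "Some j"] that i parent_eq_Some[OF F, of j] by auto
  then show ?thesis using is_tree_single_exit[OF F _ fin i(2)] E by auto
qed

end
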